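(* Let $\Sigma$ be a structurally well-posed $n\times n$ signature matrix with fine blocks $(R_1,C_1),\ldots,(R_p,C_p)$, enumerated in some order, and let $\psi:\mathbb{Z}^n\to\mathbb{Z}^p$ be the map $c\mapsto K=(c_{i_1},\ldots,c_{i_p})$, where $i_l\in R_l$ are chosen anchor indices. Then: (i) $\psi$ restricts to a bijection of the set $\mathcal{C}$ of general offset vectors $c$ of $\Sigma$ onto the set $\mathcal{K}$ of (integer) solutions $K$ of the block inequalities $K_l-K_k\ge W_{kl}$ ($k,l\in\{1,\ldots,p\}$). (ii) A vector $c\in\mathcal{C}$ is valid if and only if $K=\psi(c)$ is valid. (iii) A vector $c\in\mathcal{C}$ is normalised if and only if $K=\psi(c)$ is normalised.
   Context: A signature matrix is an $n\times n$ matrix $\Sigma=(\sigma_{ij})$ with entries in $\mathbb{Z}_{\ge0}\cup\{-\infty\}$. A transversal is a set $T$ of $n$ positions $(i,j)$ with exactly one in each row and each column; its value is $\sum_{(i,j)\in T}\sigma_{ij}$. $\Sigma$ is structurally well-posed if it has a transversal on which all $\sigma_{ij}$ are finite. A highest-value transversal (HVT) is a transversal of maximal value. The essential sparsity pattern $S_{\mathrm{ess}}$ is the union of all HVTs of $\Sigma$. The sparsity pattern of $\Sigma$ is $S=\{(i,j):\sigma_{ij}>-\infty\}$. A general offset vector of $\Sigma$ is a pair $(c,d)$ of integer $n$-vectors with $d_j-c_i\ge\sigma_{ij}$ for all $i,j$, and $d_j-c_i=\sigma_{ij}$ for all $(i,j)$ on some HVT (equivalently, on every HVT). Since $c$ determines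 $d$, one also calls $c$ itself a general offset vector. It is valid if $c_i\ge0$ for all $i$, and normalised if $\min_i c_i=0$. The canonical offset vector is the unique elementwise smallest valid one. A permuted square-block form consists of permutations $\rho$ (of rows) and $\kappa$ (of columns) of $\{1,\ldots,n\}$ and positive integers $N_1,\ldots,N_p$ summing to $n$; put $B_l=\{i : \sum_{r<l}N_r < i\le \sum_{r\le l}N_r\}$, $R_l=\rho(B_l)$, $C_l=\kappa(B_l)$. It puts a pattern $A\subseteq\{1,\ldots,n\}^2$ into (upper) block-triangular form (BTF) if $A\cap(R_k\times C_l)=\emptyset$ whenever $k>l$. A pattern containing a transversal is irreducible if no such form with $p>1$ puts it into BTF. A BTF is irreducible if each diagonal sub-pattern $A\cap(R_l\times C_l)$ is irreducible (as an $N_l\times N_l$ pattern). The set of pairs $\{(R_1,C_1),\ldots,(R_p,C_p)\}$ is the same for every irreducible BTF of $A$ and is called the irreducible emblem of $A$. The fine blocks of $\Sigma$ are the pairs in the irreducible emblem of $S_{\mathrm{ess}}$ (which equals the irreducible emblem of every $\{(i,j):d_j-c_i=\sigma_{ij}\}$ with $(c,d)$ a valid offset vector). The canonical local offsets $(\widehat c_i)_{i\in R_l}$, $(\widehat d_j)_{j\in C_l}$ of fine block $l$ are the canonical offsets of the sub-matrix $(\sigma_{ij})_{i\in R_l,j\in C_l}$ regarded as a signature matrix in its own right. The anchor index $i_l\in R_l$ is any fixed index with $\widehat c_{i_l}=0$ (one exists). For $k,l\in\{1,\ldots,p\}$, $$W_{kl}=\max\{\sigma_{ij}-\widehat d_j+\widehat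 c_i : (i,j)\in S\cap(R_k\times C_l)\},$$ with $W_{kl}=-\infty$ if the set is empty. A solution $K$ of the block inequalities is valid if all $K_l\ge0$ and normalised if $\min_l K_l=0$. *)

theory Defs
  imports Main "HOL-Library.FuncSet" "HOL-Library.Extended"
begin

text \<open>
  Sub-matrices on row set \<open>X\<close> and column set \<open>Y\<close> must be signature matrices in their own
  right, so all notions take finite index sets \<open>X\<close>, \<open>Y\<close> of equal size; an \<open>n \<times> n\<close> matrix has
  \<open>X = Y = {1..n}\<close>. Only the entries \<open>\<sigma> i j\<close> with \<open>i \<in> X\<close>, \<open>j \<in> Y\<close> matter. Entries live in
  \<open>int extended\<close> (with \<open>-\<infinity>\<close> absorbing for addition of finite entries); integer vectors indexed
  by \<open>X\<close> are the extensional functions on \<open>X\<close>, so that equality of vectors is equality of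
  functions.
\<close>

type_synonym sigmat = "nat \<Rightarrow> nat \<Rightarrow> int extended"

abbreviation int_vectors :: "nat set \<Rightarrow> (nat \<Rightarrow> int) set" where
  "int_vectors X \<equiv> X \<rightarrow>\<^sub>E UNIV"

definition signature_matrix :: "nat set \<Rightarrow> nat set \<Rightarrow> sigmat \<Rightarrow> bool" where
  "signature_matrix X Y \<sigma> \<longleftrightarrow> finite X \<and> finite Y \<and> card X = card Y \<and>
     (\<forall>i\<in>X. \<forall>j\<in>Y. \<sigma> i j = -\<infinity> \<or> (\<exists>m\<ge>0. \<sigma> i j = Fin m))"


section \<open>Transversals and sparsity patterns\<close>

definition transversal :: "nat set \<Rightarrow> nat set \<Rightarrow> (nat \<times> nat) set \<Rightarrow> bool" where
  "transversal X Y T \<longleftrightarrow> T \<subseteq> X \<times> Y \<and>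
     (\<forall>i\<in>X. \<exists>!j. (i, j) \<in> T) \<and> (\<forall>j\<in>Y. \<exists>!i. (i, j) \<in> T)"

definition transversal_value :: "sigmat \<Rightarrow> (nat \<times> nat) set \<Rightarrow> int extended" where
  "transversal_value \<sigma> T = (\<Sum>(i, j)\<in>T. \<sigma> i j)"

definition structurally_well_posed :: "nat set \<Rightarrow> nat set \<Rightarrow> sigmat \<Rightarrow> bool" where
  "structurally_well_posed X Y \<sigma> \<longleftrightarrow>
     (\<exists>T. transversal X Y T \<and> (\<forall>(i, j)\<in>T. \<sigma> i j > -\<infinity>))"

definition HVT :: "nat set \<Rightarrow> nat set \<Rightarrow> sigmat \<Rightarrow> (nat \<times> nat) set \<Rightarrow> bool" where
  "HVT X Y \<sigma> T \<longleftrightarrow> transversal X Y T \<and>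
     (\<forall>T'. transversal X Y T' \<longrightarrow> transversal_value \<sigma> T' \<le> transversal_value \<sigma> T)"

definition essential_pattern :: "nat set \<Rightarrow> nat set \<Rightarrow> sigmat \<Rightarrow> (nat \<times> nat) set" where
  "essential_pattern X Y \<sigma> = \<Union> {T. HVT X Y \<sigma> T}"

definition sparsity_pattern :: "nat set \<Rightarrow> nat set \<Rightarrow> sigmat \<Rightarrow> (nat \<times> nat) set" where
  "sparsity_pattern X Y \<sigma> = {(i, j) \<in> X \<times> Y. \<sigma> i j > -\<infinity>}"


section \<open>Offset vectors\<close>

definition general_offset_pair ::
    "nat set \<Rightarrow> nat set \<Rightarrow> sigmat \<Rightarrow> (nat \<Rightarrow> int) \<Rightarrow> (nat \<Rightarrow> int) \<Rightarrow> bool" where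
  "general_offset_pair X Y \<sigma> c d \<longleftrightarrow> c \<in> int_vectors X \<and> d \<in> int_vectors Y \<and>
     (\<forall>i\<in>X. \<forall>j\<in>Y. Fin (d j - c i) \<ge> \<sigma> i j) \<and>
     (\<exists>T. HVT X Y \<sigma> T \<and> (\<forall>(i, j)\<in>T. Fin (d j - c i) = \<sigma> i j))"

definition general_offset_vectors :: "nat set \<Rightarrow> nat set \<Rightarrow> sigmat \<Rightarrow> (nat \<Rightarrow> int) set" where
  "general_offset_vectors X Y \<sigma> = {c. \<exists>d. general_offset_pair X Y \<sigma> c d}"

text \<open>These two apply to row offsets \<open>c\<close> (index set \<open>X\<close>) as well as to block offsets \<open>K\<close>
  (index set \<open>{1..p}\<close>).\<close>

definition valid :: "nat set \<Rightarrow> (nat \<Rightarrow> int) \<Rightarrow> bool" where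
  "valid I v \<longleftrightarrow> (\<forall>i\<in>I. v i \<ge> 0)"

definition normalised :: "nat set \<Rightarrow> (nat \<Rightarrow> int) \<Rightarrow> bool" where
  "normalised I v \<longleftrightarrow> Min (v ` I) = 0"

definition canonical_offsets ::
    "nat set \<Rightarrow> nat set \<Rightarrow> sigmat \<Rightarrow> (nat \<Rightarrow> int) \<times> (nat \<Rightarrow> int)" where
  "canonical_offsets X Y \<sigma> = (THE (c, d). general_offset_pair X Y \<sigma> c d \<and> valid X c \<and>
     (\<forall>c'\<in>general_offset_vectors X Y \<sigma>. valid X c' \<longrightarrow> (\<forall>i\<in>X. c i \<le> c' i)))"

abbreviation canonical_c :: "nat set \<Rightarrow> nat set \<Rightarrow> sigmat \<Rightarrow> nat \<Rightarrow> int" where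
  "canonical_c X Y \<sigma> \<equiv> fst (canonical_offsets X Y \<sigma>)"

abbreviation canonical_d :: "nat set \<Rightarrow> nat set \<Rightarrow> sigmat \<Rightarrow> nat \<Rightarrow> int" where
  "canonical_d X Y \<sigma> \<equiv> snd (canonical_offsets X Y \<sigma>)"


section \<open>Block-triangular forms\<close>

definition permuted_block_form ::
    "nat set \<Rightarrow> nat set \<Rightarrow> nat \<Rightarrow> (nat \<Rightarrow> nat) \<Rightarrow> (nat \<Rightarrow> nat) \<Rightarrow> (nat \<Rightarrow> nat) \<Rightarrow> bool" where
  "permuted_block_form X Y p N \<rho> \<kappa> \<longleftrightarrow>
     bij_betw \<rho> {1..card X} X \<and> bij_betw \<kappa> {1..card Y} Y \<and>
     (\<forall>l\<in>{1..p}. N l > 0) \<and> (\<Sum>l\<in>{1..p}. N l) = card X"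

definition block_positions :: "(nat \<Rightarrow> nat) \<Rightarrow> nat \<Rightarrow> nat set" where
  "block_positions N l = {i. (\<Sum>r\<in>{1..<l}. N r) < i \<and> i \<le> (\<Sum>r\<in>{1..l}. N r)}"

definition puts_into_BTF ::
    "nat \<Rightarrow> (nat \<Rightarrow> nat) \<Rightarrow> (nat \<Rightarrow> nat) \<Rightarrow> (nat \<Rightarrow> nat) \<Rightarrow> (nat \<times> nat) set \<Rightarrow> bool" where
  "puts_into_BTF p N \<rho> \<kappa> A \<longleftrightarrow> (\<forall>k\<in>{1..p}. \<forall>l\<in>{1..p}. k > l \<longrightarrow>
     A \<inter> (\<rho> ` block_positions N k \<times> \<kappa> ` block_positions N l) = {})"

definition irreducible_pattern :: "nat set \<Rightarrow> nat set \<Rightarrow> (nat \<times> nat) set \<Rightarrow> bool" where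
  "irreducible_pattern X Y A \<longleftrightarrow> (\<exists>T. transversal X Y T \<and> T \<subseteq> A) \<and>
     \<not> (\<exists>p N \<rho> \<kappa>. p > 1 \<and> permuted_block_form X Y p N \<rho> \<kappa> \<and> puts_into_BTF p N \<rho> \<kappa> A)"

definition irreducible_BTF ::
    "nat set \<Rightarrow> nat set \<Rightarrow> (nat \<times> nat) set \<Rightarrow>
     nat \<Rightarrow> (nat \<Rightarrow> nat) \<Rightarrow> (nat \<Rightarrow> nat) \<Rightarrow> (nat \<Rightarrow> nat) \<Rightarrow> bool" where
  "irreducible_BTF X Y A p N \<rho> \<kappa> \<longleftrightarrow>
     permuted_block_form X Y p N \<rho> \<kappa> \<and> puts_into_BTF p N \<rho> \<kappa> A \<and>
     (\<forall>l\<in>{1..p}. let R = \<rho> ` block_positions N l; C = \<kappa> ` block_positions N l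
                 in irreducible_pattern R C (A \<inter> (R \<times> C)))"

text \<open>The set of block pairs does not depend on the irreducible BTF chosen, so the emblem is given
  as the relation ``\<open>E\<close> is the set of block pairs of an irreducible BTF of \<open>A\<close>''.\<close>

definition is_irreducible_emblem ::
    "nat set \<Rightarrow> nat set \<Rightarrow> (nat \<times> nat) set \<Rightarrow> (nat set \<times> nat set) set \<Rightarrow> bool" where
  "is_irreducible_emblem X Y A E \<longleftrightarrow> (\<exists>p N \<rho> \<kappa>. irreducible_BTF X Y A p N \<rho> \<kappa> \<and>
     E = (\<lambda>l. (\<rho> ` block_positions N l, \<kappa> ` block_positions N l)) ` {1..p})"

text \<open>\<open>(R 1, C 1), \<dots>, (R p, C p)\<close> lists the fine blocks without repetition, in any order
  (not necessarily one that makes a pattern block-triangular).\<close>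

definition fine_block_enumeration ::
    "nat \<Rightarrow> sigmat \<Rightarrow> nat \<Rightarrow> (nat \<Rightarrow> nat set) \<Rightarrow> (nat \<Rightarrow> nat set) \<Rightarrow> bool" where
  "fine_block_enumeration n \<sigma> p R C \<longleftrightarrow>
     (\<exists>E. is_irreducible_emblem {1..n} {1..n} (essential_pattern {1..n} {1..n} \<sigma>) E \<and>
          bij_betw (\<lambda>l. (R l, C l)) {1..p} E)"


section \<open>The block inequalities\<close>

definition block_W ::
    "nat \<Rightarrow> sigmat \<Rightarrow> (nat \<Rightarrow> nat set) \<Rightarrow> (nat \<Rightarrow> nat set) \<Rightarrow> nat \<Rightarrow> nat \<Rightarrow> int extended" where
  "block_W n \<sigma> R C k l =
     (let V = {\<sigma> i j - Fin (canonical_d (R l) (C l) \<sigma> j) + Fin (canonical_c (R k) (C k) \<sigma> i) | i j.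
                 (i, j) \<in> sparsity_pattern {1..n} {1..n} \<sigma> \<inter> (R k \<times> C l)}
      in if V = {} then -\<infinity> else Max V)"

definition block_solutions ::
    "nat \<Rightarrow> sigmat \<Rightarrow> nat \<Rightarrow> (nat \<Rightarrow> nat set) \<Rightarrow> (nat \<Rightarrow> nat set) \<Rightarrow> (nat \<Rightarrow> int) set" where
  "block_solutions n \<sigma> p R C =
     {K \<in> int_vectors {1..p}. \<forall>k\<in>{1..p}. \<forall>l\<in>{1..p}. Fin (K l - K k) \<ge> block_W n \<sigma> R C k l}"

definition anchor_indices ::
    "sigmat \<Rightarrow> nat \<Rightarrow> (nat \<Rightarrow> nat set) \<Rightarrow> (nat \<Rightarrow> nat set) \<Rightarrow> (nat \<Rightarrow> nat) \<Rightarrow> bool" where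
  "anchor_indices \<sigma> p R C a \<longleftrightarrow>
     (\<forall>l\<in>{1..p}. a l \<in> R l \<and> canonical_c (R l) (C l) \<sigma> (a l) = 0)"

definition anchor_map :: "nat \<Rightarrow> (nat \<Rightarrow> nat) \<Rightarrow> (nat \<Rightarrow> int) \<Rightarrow> (nat \<Rightarrow> int)" where
  "anchor_map p a c = (\<lambda>l\<in>{1..p}. c (a l))"

end

theory Submission
  imports Defs "HOL-Combinatorics.Cycles"
begin

text \<open>
  Complementary slackness: every offset vector is tight on the whole essential pattern. Hence the
  row and column differences of two offset vectors of a fine block label its rows and columns so
  that labels agree along the pattern; a non-constant labelling would split the irreducible block,
  so the two vectors differ by a constant. On \<open>R\<^sub>l\<close>, a general offset vector \<open>c\<close> is therefore the
  canonical local one shifted by \<open>K\<^sub>l = c (a l)\<close>, and the inequalities \<open>d\<^sub>j - c\<^sub>i \<ge> \<sigma>\<^sub>i\<^sub>j\<close> become the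
  block inequalities. Offset vectors of a block exist by linear programming duality for the
  assignment problem: potentials are greatest weights of simple paths.
\<close>

section \<open>Transversals\<close>

text \<open>Canonical offsets are given by \<open>THE\<close>, which says nothing until a smallest
  valid offset vector of each fine block is known to exist and to be unique. This forces the duality
  argument: building a preimage of a block solution needs actual local offsets to start from. For an
  arbitrary signature matrix a smallest vector would take an extra argument; on an irreducible block
  the offset vectors are translates of one another, so the smallest valid one is the translate with
  minimum 0. The other obstacle is that the blocks are listed in any order and their local notions
  refer to sub-matrices. Block-triangularity therefore serves only to show that every HVT stays
  inside the diagonal blocks. From there on the fine blocks are a partition of rows and of columns
  that every HVT respects, and an HVT of the whole matrix cuts into HVTs of the blocks. Arithmetic
  takes place in the integers: well-posedness keeps every HVT inside the sparsity pattern, and at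
  entries \<open>-\<infinity>\<close> the required inequalities are trivial.\<close>

lemma transversal_graph:
  assumes "bij_betw t X Y"
  shows "transversal X Y ((\<lambda>i. (i, t i)) ` X)"
  unfolding transversal_def
proof (intro conjI ballI)
  show "(\<lambda>i. (i, t i)) ` X \<subseteq> X \<times> Y" using assms by (auto simp: bij_betw_def)
  show "\<exists>!j. (i, j) \<in> (\<lambda>i. (i, t i)) ` X" if "i \<in> X" for i
    using that by auto
  fix j assume "j \<in> Y"
  then obtain i where "i \<in> X" "j = t i" using assms by (auto simp: bij_betw_def)
  then show "\<exists>!i. (i, j) \<in> (\<lambda>i. (i, t i)) ` X"
    using assms by (intro ex1I[of _ i]) (auto simp: bij_betw_def dest: inj_onD)
qed

text \<open>Sets of positions match the definition, but sums are reindexed along functions and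
  permutations compose with them.\<close>

lemma transversalE:
  assumes "transversal X Y T"
  obtains t where "bij_betw t X Y" "T = (\<lambda>i. (i, t i)) ` X"
proof -
  have T: "T \<subseteq> X \<times> Y" and ex1: "\<And>i. i \<in> X \<Longrightarrow> \<exists>!j. (i, j) \<in> T" "\<And>j. j \<in> Y \<Longrightarrow> \<exists>!i. (i, j) \<in> T"
    using assms unfolding transversal_def by auto
  define t where "t i = (THE j. (i, j) \<in> T)" for i
  have tT: "(i, t i) \<in> T" if "i \<in> X" for i
    unfolding t_def by (rule theI'[OF ex1(1)[OF that]])
  have uniq: "j = t i" if "(i, j) \<in> T" for i j
    using ex1(1)[of i] tT[of i] that T by blast
  have "inj_on t X"
  proof (rule inj_onI)
    fix i i' assume i: "i \<in> X" "i' \<in> X" "t i = t i'"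
    then have "t i \<in> Y" "(i, t i) \<in> T" "(i', t i) \<in> T" using tT[of i] tT[of i'] T by auto
    then show "i = i'" using ex1(2) by blast
  qed
  moreover have "t ` X = Y"
  proof
    show "t ` X \<subseteq> Y" using tT T by blast
    show "Y \<subseteq> t ` X"
    proof
      fix j assume "j \<in> Y"
      then obtain i where "(i, j) \<in> T" using ex1(2) by blast
      then show "j \<in> t ` X" using uniq T by blast
    qed
  qed
  ultimately have "bij_betw t X Y" by (simp add: bij_betw_def)
  moreover have "T = (\<lambda>i. (i, t i)) ` X"
    using tT uniq T by auto
  ultimately show thesis by (rule that)
qed

lemma transversal_subset: "transversal X Y T \<Longrightarrow> T \<subseteq> X \<times> Y"
  by (simp add: transversal_def)

lemma transversal_finite: "transversal X Y T \<Longrightarrow> finite X \<Longrightarrow> finite T"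
  by (auto elim!: transversalE)

lemma transversal_card: "transversal X Y T \<Longrightarrow> card X = card Y"
  by (auto elim!: transversalE dest: bij_betw_same_card)

lemma transversal_column: "transversal X Y T \<Longrightarrow> j \<in> Y \<Longrightarrow> \<exists>i\<in>X. (i, j) \<in> T"
  unfolding transversal_def by blast

text \<open>A function of the row alone has the same sum over every transversal. With the column
  version this gives all transversals the same dual value, and lets block indices be compared by
  their sums.\<close>

lemma transversal_sum_fst:
  assumes "transversal X Y T"
  shows "(\<Sum>(i, j)\<in>T. f i) = sum f X"
proof -
  obtain t where T: "T = (\<lambda>i. (i, t i)) ` X" using assms by (rule transversalE)
  have "inj_on (\<lambda>i. (i, t i)) X" by (auto intro: inj_onI)
  then show ?thesis unfolding T by (simp add: sum.reindex)
qed

lemma transversal_sum_snd: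
  assumes "transversal X Y T"
  shows "(\<Sum>(i, j)\<in>T. f j) = sum f Y"
proof -
  obtain t where t: "bij_betw t X Y" and T: "T = (\<lambda>i. (i, t i)) ` X" using assms by (rule transversalE)
  have "inj_on (\<lambda>i. (i, t i)) X" by (auto intro: inj_onI)
  then show ?thesis unfolding T using sum.reindex_bij_betw[OF t, of f] by (simp add: sum.reindex)
qed

lemma transversal_Un:
  assumes "transversal X Y T" "transversal X' Y' T'" "X \<inter> X' = {}" "Y \<inter> Y' = {}"
  shows "transversal (X \<union> X') (Y \<union> Y') (T \<union> T')"
proof -
  have sub: "T \<subseteq> X \<times> Y" "T' \<subseteq> X' \<times> Y'" using assms(1,2) by (auto simp: transversal_def)
  have "(i, j) \<in> T \<union> T' \<longleftrightarrow> (i, j) \<in> T" if "i \<in> X \<or> j \<in> Y" for i j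
    using that sub assms(3,4) by blast
  moreover have "(i, j) \<in> T \<union> T' \<longleftrightarrow> (i, j) \<in> T'" if "i \<in> X' \<or> j \<in> Y'" for i j
    using that sub assms(3,4) by blast
  moreover have "T \<union> T' \<subseteq> (X \<union> X') \<times> (Y \<union> Y')" using sub by blast
  ultimately show ?thesis using assms(1,2) unfolding transversal_def by (simp add: Ball_def Un_iff)
qed

text \<open>The last hypothesis says that no position of \<open>T\<close> leaves
  \<open>X' \<times> Y'\<close> sideways. It holds for diagonal blocks, for their complements and
  for level sets of a labelling that agrees along \<open>T\<close>.\<close>

lemma transversal_restrict:
  assumes "transversal X Y T" "X' \<subseteq> X" "Y' \<subseteq> Y" "\<And>i j. (i, j) \<in> T \<Longrightarrow> i \<in> X' \<longleftrightarrow> j \<in> Y'"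
  shows "transversal X' Y' (T \<inter> X' \<times> Y')"
proof -
  have "(\<lambda>j. (i, j) \<in> T \<inter> X' \<times> Y') = (\<lambda>j. (i, j) \<in> T)" if "i \<in> X'" for i
    using that assms(4) by blast
  moreover have "(\<lambda>i. (i, j) \<in> T \<inter> X' \<times> Y') = (\<lambda>i. (i, j) \<in> T)" if "j \<in> Y'" for j
    using that assms(4) by blast
  moreover have "\<exists>!j. (i, j) \<in> T" if "i \<in> X'" for i
    using assms(1,2) that unfolding transversal_def by blast
  moreover have "\<exists>!i. (i, j) \<in> T" if "j \<in> Y'" for j
    using assms(1,3) that unfolding transversal_def by blast
  ultimately show ?thesis unfolding transversal_def by simp
qed


section \<open>Highest-value transversals\<close>

text \<open>The value \<open>0\<close> at infinite entries is junk; only finite entries are ever summed.\<close>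

fun fin_part :: "int extended \<Rightarrow> int" where
  "fin_part (Fin m) = m"
| "fin_part _ = 0"

lemma Fin_fin_part:
  assumes "signature_matrix X Y \<sigma>" "(i, j) \<in> sparsity_pattern X Y \<sigma>"
  shows "\<sigma> i j = Fin (fin_part (\<sigma> i j))"
  using assms unfolding signature_matrix_def sparsity_pattern_def by fastforce

text \<open>The value as an integer, so that subtraction, cancellation and termwise comparison are
  available; inside the sparsity pattern it agrees with \<open>transversal_value\<close>.\<close>

definition finite_value :: "sigmat \<Rightarrow> (nat \<times> nat) set \<Rightarrow> int" where
  "finite_value \<sigma> T = (\<Sum>(i, j)\<in>T. fin_part (\<sigma> i j))"

lemma sum_Fin: "(\<Sum>x\<in>A. Fin (f x)) = Fin (\<Sum>x\<in>A. f x :: int)"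
  by (induction A rule: infinite_finite_induct) (auto simp: zero_extended_def)

lemma transversal_value_finite:
  assumes "signature_matrix X Y \<sigma>" "T \<subseteq> sparsity_pattern X Y \<sigma>"
  shows "transversal_value \<sigma> T = Fin (finite_value \<sigma> T)"
proof -
  have "transversal_value \<sigma> T = (\<Sum>(i, j)\<in>T. Fin (fin_part (\<sigma> i j)))"
    unfolding transversal_value_def
    by (rule sum.cong) (use assms Fin_fin_part in auto)
  then show ?thesis by (simp add: finite_value_def sum_Fin case_prod_beta)
qed

lemma transversal_value_Minf:
  assumes "signature_matrix X Y \<sigma>" "T \<subseteq> X \<times> Y" "\<not> T \<subseteq> sparsity_pattern X Y \<sigma>"
  shows "transversal_value \<sigma> T = -\<infinity>"
proof -
  have fin: "finite T" using assms(1,2) by (meson finite_SigmaI finite_subset signature_matrix_def)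
  obtain i j where ij: "(i, j) \<in> T" "\<sigma> i j = -\<infinity>"
    using assms(2,3) by (fastforce simp: sparsity_pattern_def less_le)
  \<comment> \<open>In \<open>extended\<close>,
    \<open>-\<infinity> + \<infinity> = \<infinity>\<close>, so an entry \<open>-\<infinity>\<close>
    determines the sum only once the remaining sum is known not to be
    \<open>\<infinity>\<close>.\<close>
  have no: "(\<Sum>(i, j)\<in>T'. \<sigma> i j) \<noteq> \<infinity>" if "T' \<subseteq> X \<times> Y" for T'
    using finite_subset[OF that] that
  proof (induction T' rule: infinite_finite_induct)
    case (insert x F)
    then have "case_prod \<sigma> x \<noteq> \<infinity>" using assms(1) by (fastforce simp: signature_matrix_def)
    moreover have "(\<Sum>(i, j)\<in>F. \<sigma> i j) \<noteq> \<infinity>" using insert by (meson finite_subset insert_subset)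
    ultimately show ?case using insert
      by (cases "case_prod \<sigma> x"; cases "\<Sum>(i, j)\<in>F. \<sigma> i j") auto
  qed (auto simp: zero_extended_def)
  have "transversal_value \<sigma> T = \<sigma> i j + (\<Sum>(i, j)\<in>T - {(i, j)}. \<sigma> i j)"
    unfolding transversal_value_def using sum.remove[OF fin ij(1), of "case_prod \<sigma>"] by simp
  moreover have "(\<Sum>(i, j)\<in>T - {(i, j)}. \<sigma> i j) \<noteq> \<infinity>" using no assms(2) by blast
  ultimately show ?thesis using ij(2) by (cases "\<Sum>(i, j)\<in>T - {(i, j)}. \<sigma> i j") auto
qed

lemma structurally_well_posed_iff:
  "structurally_well_posed X Y \<sigma> \<longleftrightarrow> (\<exists>T. transversal X Y T \<and> T \<subseteq> sparsity_pattern X Y \<sigma>)"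
  unfolding structurally_well_posed_def
  by (rule iff_exI) (auto simp: sparsity_pattern_def dest: transversal_subset)

text \<open>Well-posedness supplies a competitor of finite value, so an HVT cannot have value
  \<open>-\<infinity>\<close>; conversely, transversals that leave the sparsity pattern have value
  \<open>-\<infinity>\<close> and are beaten for free.\<close>

lemma HVT_iff:
  assumes "signature_matrix X Y \<sigma>" "structurally_well_posed X Y \<sigma>"
  shows "HVT X Y \<sigma> T \<longleftrightarrow> transversal X Y T \<and> T \<subseteq> sparsity_pattern X Y \<sigma> \<and>
    (\<forall>T'. transversal X Y T' \<and> T' \<subseteq> sparsity_pattern X Y \<sigma> \<longrightarrow> finite_value \<sigma> T' \<le> finite_value \<sigma> T)"
    (is "?L \<longleftrightarrow> ?R")
proof
  assume L: ?L
  obtain T0 where T0: "transversal X Y T0" "T0 \<subseteq> sparsity_pattern X Y \<sigma>"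
    using assms(2) structurally_well_posed_iff by blast
  have T: "transversal X Y T" using L by (simp add: HVT_def)
  have "transversal_value \<sigma> T0 \<le> transversal_value \<sigma> T" using L T0 by (simp add: HVT_def)
  then have "transversal_value \<sigma> T \<noteq> -\<infinity>"
    using transversal_value_finite[OF assms(1) T0(2)] by auto
  then have S: "T \<subseteq> sparsity_pattern X Y \<sigma>"
    using transversal_value_Minf[OF assms(1) transversal_subset[OF T]] by blast
  show ?R
  proof (intro conjI allI impI T S)
    fix T' assume "transversal X Y T' \<and> T' \<subseteq> sparsity_pattern X Y \<sigma>"
    then show "finite_value \<sigma> T' \<le> finite_value \<sigma> T"
      using L S transversal_value_finite[OF assms(1)] by (force simp: HVT_def)
  qed
next
  assume R: ?R
  show ?L unfolding HVT_def
  proof (intro conjI allI impI)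
    show "transversal X Y T" using R by blast
    fix T' assume T': "transversal X Y T'"
    show "transversal_value \<sigma> T' \<le> transversal_value \<sigma> T"
    proof (cases "T' \<subseteq> sparsity_pattern X Y \<sigma>")
      case True
      then show ?thesis using R T' transversal_value_finite[OF assms(1)] by simp
    next
      case False
      then show ?thesis using transversal_value_Minf[OF assms(1) transversal_subset[OF T']] by simp
    qed
  qed
qed

lemma ex_HVT:
  assumes "signature_matrix X Y \<sigma>" "structurally_well_posed X Y \<sigma>"
  shows "\<exists>T. HVT X Y \<sigma> T"
proof -
  let ?F = "{T. transversal X Y T \<and> T \<subseteq> sparsity_pattern X Y \<sigma>}"
  have "finite (Pow (X \<times> Y))" using assms(1) by (simp add: signature_matrix_def)
  then have "finite ?F" by (rule finite_subset[rotated]) (auto simp: transversal_def)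
  moreover have "?F \<noteq> {}" using assms(2) by (auto simp: structurally_well_posed_iff)
  ultimately obtain T where "is_arg_min (\<lambda>T. - finite_value \<sigma> T) (\<lambda>T. T \<in> ?F) T"
    using ex_is_arg_min_if_finite by blast
  then have "T \<in> ?F" "\<And>T'. T' \<in> ?F \<Longrightarrow> finite_value \<sigma> T' \<le> finite_value \<sigma> T"
    by (simp_all add: is_arg_min_linorder)
  then show ?thesis using HVT_iff[OF assms] by blast
qed


section \<open>Existence of offset vectors\<close>

definition path_weight :: "('a \<Rightarrow> 'a \<Rightarrow> int) \<Rightarrow> 'a list \<Rightarrow> int" where
  "path_weight g xs = sum_list (map2 g xs (tl xs))"

lemma path_weight_simps [simp]:
  "path_weight g [] = 0"
  "path_weight g [x] = 0"
  "path_weight g (x # y # xs) = g x y + path_weight g (y # xs)"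
  by (simp_all add: path_weight_def)

lemma path_weight_append:
  "path_weight g (xs @ y # zs) = path_weight g (xs @ [y]) + path_weight g (y # zs)"
proof (induction xs)
  case (Cons x xs)
  then show ?case by (cases xs) auto
qed simp

text \<open>The potential of \<open>j\<close> is the greatest weight of a simple path ending in \<open>j\<close>. Appending an edge
  to a simple path can only close a single simple cycle, whose weight is not positive.\<close>

lemma ex_potential:
  fixes g :: "'a \<Rightarrow> 'a \<Rightarrow> int"
  assumes "finite X"
    and cyc: "\<And>cs. \<lbrakk>cs \<noteq> []; distinct cs; set cs \<subseteq> X; successively E (cs @ [hd cs])\<rbrakk>
               \<Longrightarrow> path_weight g (cs @ [hd cs]) \<le> 0"
  shows "\<exists>c. \<forall>i\<in>X. \<forall>j\<in>X. E i j \<longrightarrow> g i j \<le> c j - c i"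
proof -
  define P where "P j = {xs. distinct xs \<and> set xs \<subseteq> X \<and> xs \<noteq> [] \<and> last xs = j \<and> successively E xs}" for j
  define c where "c j = Max (path_weight g ` P j)" for j
  have "finite (P j)" for j
    by (rule finite_subset[OF _ finite_subset_distinct[OF assms(1)]]) (auto simp: P_def)
  then have le_c: "path_weight g xs \<le> c j" if "xs \<in> P j" for xs j
    using that by (simp add: c_def)
  have attained: "\<exists>xs\<in>P j. c j = path_weight g xs" if "j \<in> X" for j
  proof -
    have "[j] \<in> P j" using that by (simp add: P_def)
    then have "c j \<in> path_weight g ` P j"
      unfolding c_def using \<open>finite (P j)\<close> by (intro Max_in) auto
    then show ?thesis by blast
  qed
  have "g i j \<le> c j - c i" if "i \<in> X" "j \<in> X" "E i j" for i j
  proof -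
    obtain xs where xs: "xs \<in> P i" "c i = path_weight g xs" using attained \<open>i \<in> X\<close> by blast
    obtain us where us: "xs = us @ [i]" 
      using xs(1) append_butlast_last_id[of xs] by (simp add: P_def) metis
    have w: "path_weight g (xs @ [j]) = c i + g i j"
      using path_weight_append[of g us i "[j]"] by (simp add: us xs(2))
    have succ: "successively E (xs @ [j])"
      using xs(1) \<open>E i j\<close> by (auto simp: P_def successively_append_iff)
    show ?thesis
    proof (cases "j \<in> set xs")
      case False
      then have "xs @ [j] \<in> P j" using xs(1) succ \<open>j \<in> X\<close> by (auto simp: P_def)
      then show ?thesis using le_c[of "xs @ [j]" j] w by simp
    next
      case True
      then obtain ys zs where split: "xs = ys @ j # zs" by (meson split_list)
      have "ys @ [j] \<in> P j" using xs(1) by (auto simp: P_def split successively_append_iff)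
      then have "path_weight g (ys @ [j]) \<le> c j" by (rule le_c)
      moreover have "path_weight g ((j # zs) @ [hd (j # zs)]) \<le> 0"
        by (rule cyc) (use xs(1) succ in \<open>auto simp: P_def split successively_append_iff successively_Cons\<close>)
      ultimately show ?thesis
        using w path_weight_append[of g ys j "zs @ [j]"] by (simp add: split)
    qed
  qed
  then show ?thesis by blast
qed

text \<open>\<open>cycle_of_list cs\<close> sends each element to its cyclic successor, so mapping
  it over \<open>cs\<close> gives \<open>rotate1 cs\<close>, and the pairs summed are the edges of
  the closed path. This translates cycle weights into sums over a permutation.\<close>

lemma sum_cycle_of_list:
  assumes "distinct cs" "cs \<noteq> []"
  shows "(\<Sum>i\<in>set cs. g i (cycle_of_list cs i)) = path_weight g (cs @ [hd cs])"
proof -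
  have "map (cycle_of_list cs) cs = rotate1 cs" using cyclic_rotation[OF assms(1), of 1] by simp
  moreover have "map (\<lambda>i. g i (cycle_of_list cs i)) cs = map2 g cs (map (cycle_of_list cs) cs)"
    by (simp add: zip_map2 zip_same_conv_map)
  ultimately have m: "map (\<lambda>i. g i (cycle_of_list cs i)) cs = map2 g cs (rotate1 cs)"
    by simp
  show ?thesis
    using assms unfolding sum.distinct_set_conv_list[OF assms(1)] m path_weight_def
    using zip_append1[of cs "[hd cs]" "tl cs @ [hd cs]"] by (cases cs) auto
qed

lemma successively_cycle_of_list:
  assumes "distinct cs" "cs \<noteq> []" "successively E (cs @ [hd cs])" "i \<in> set cs"
  shows "E i (cycle_of_list cs i)"
proof -
  have m: "map (cycle_of_list cs) cs = rotate1 cs" using cyclic_rotation[OF assms(1), of 1] by simp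
  obtain k where k: "k < length cs" "i = cs ! k" using assms(4) by (metis in_set_conv_nth)
  have "cycle_of_list cs i = rotate1 cs ! k" using k m by (metis nth_map)
  also have "\<dots> = (cs @ [hd cs]) ! Suc k" using k(1) by (cases cs) (auto simp: nth_append)
  finally show ?thesis
    using assms(3) k successively_nth[of E "cs @ [hd cs]" k] by (simp add: nth_append)
qed

text \<open>Permuting the columns of an HVT along a cycle of rows gives another transversal, so
  optimality bounds the weight of every cycle by 0 and a potential exists. Columns are named by the
  row that the HVT assigns to them, which makes rows the only vertices.\<close>

lemma ex_general_offset_pair:
  assumes sig: "signature_matrix X Y \<sigma>" and swp: "structurally_well_posed X Y \<sigma>"
  shows "\<exists>c d. general_offset_pair X Y \<sigma> c d"
proof -
  obtain T where T: "HVT X Y \<sigma> T" using ex_HVT[OF assms] by blast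
  let ?S = "sparsity_pattern X Y \<sigma>"
  have finX: "finite X" using sig by (simp add: signature_matrix_def)
  have TS: "transversal X Y T" "T \<subseteq> ?S"
    and opt: "\<And>T'. transversal X Y T' \<Longrightarrow> T' \<subseteq> ?S \<Longrightarrow> finite_value \<sigma> T' \<le> finite_value \<sigma> T"
    using T HVT_iff[OF assms] by blast+
  obtain t where t: "bij_betw t X Y" and Tt: "T = (\<lambda>i. (i, t i)) ` X" using TS(1) by (rule transversalE)
  define s where "s i j = fin_part (\<sigma> i (t j))" for i j
  have value_graph: "finite_value \<sigma> ((\<lambda>i. (i, f i)) ` X) = (\<Sum>i\<in>X. fin_part (\<sigma> i (f i)))" for f
    unfolding finite_value_def by (subst sum.reindex) (auto intro: inj_onI)
  define E where "E i j \<longleftrightarrow> (i, t j) \<in> ?S" for i j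
  \<comment> \<open>Tightness on \<open>T\<close> forces \<open>d (t j) = c j + s j j\<close>;
    substituting this into \<open>d (t j) - c i \<ge> s i j\<close> leaves
    \<open>g i j \<le> c j - c i\<close>, a potential condition on \<open>c\<close> alone.\<close>
  define g where "g i j = s i j - s j j" for i j
  have "path_weight g (cs @ [hd cs]) \<le> 0"
    if cs: "cs \<noteq> []" "distinct cs" "set cs \<subseteq> X" "successively E (cs @ [hd cs])" for cs
  proof -
    define \<pi> where "\<pi> = cycle_of_list cs"
    have \<pi>: "\<pi> permutes X" unfolding \<pi>_def using cycle_permutes cs(3) by (rule permutes_subset)
    have \<pi>_id: "\<pi> i = i" if "i \<notin> set cs" for i using that by (simp add: \<pi>_def id_outside_supp)
    have bij: "bij_betw (t \<circ> \<pi>) X Y" using permutes_imp_bij[OF \<pi>] t by (rule bij_betw_trans)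
    have "(i, t (\<pi> i)) \<in> ?S" if "i \<in> X" for i
      using successively_cycle_of_list[OF cs(2,1,4), of i] \<pi>_id[of i] TS(2) Tt that
      by (cases "i \<in> set cs") (auto simp: E_def \<pi>_def)
    then have "(\<Sum>i\<in>X. s i (\<pi> i)) \<le> (\<Sum>i\<in>X. s i i)"
      using opt[OF transversal_graph[OF bij]] value_graph[of t] value_graph[of "t \<circ> \<pi>"]
      by (auto simp: s_def Tt)
    \<comment> \<open>Hence the sum of \<open>g i (\<pi> i)\<close> is the value of the permuted
      transversal minus the value of \<open>T\<close>. Rows off the cycle contribute
      \<open>g i i = 0\<close>.\<close>
    moreover have "(\<Sum>i\<in>X. s (\<pi> i) (\<pi> i)) = (\<Sum>i\<in>X. s i i)"
      using sum.reindex_bij_betw[OF permutes_imp_bij[OF \<pi>], of "\<lambda>i. s i i"] .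
    ultimately have "(\<Sum>i\<in>X. g i (\<pi> i)) \<le> 0" by (simp add: g_def sum_subtractf)
    moreover have "(\<Sum>i\<in>X. g i (\<pi> i)) = (\<Sum>i\<in>set cs. g i (\<pi> i))"
      by (rule sum.mono_neutral_right) (use finX cs(3) \<pi>_id in \<open>auto simp: g_def\<close>)
    ultimately show ?thesis using sum_cycle_of_list[OF cs(2,1), of g] by (simp add: \<pi>_def)
  qed
  from ex_potential[OF finX this] obtain c
    where c: "\<And>i j. i \<in> X \<Longrightarrow> j \<in> X \<Longrightarrow> E i j \<Longrightarrow> g i j \<le> c j - c i" by blast
  define d where "d j = (let i = inv_into X t j in c i + s i i)" for j
  have dt: "d (t i) = c i + s i i" if "i \<in> X" for i
    using t that by (simp add: d_def Let_def bij_betw_def)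
  have "general_offset_pair X Y \<sigma> (restrict c X) (restrict d Y)"
    unfolding general_offset_pair_def
  proof (intro conjI ballI exI[of _ T] T)
    fix i j assume ij: "i \<in> X" "j \<in> Y"
    then obtain k where k: "k \<in> X" "j = t k" using t by (auto simp: bij_betw_def)
    show "\<sigma> i j \<le> Fin (restrict d Y j - restrict c X i)"
    proof (cases "(i, j) \<in> ?S")
      case True
      then have "s i k \<le> d j - c i" using c[of i k] dt[OF k(1)] ij k by (simp add: g_def E_def)
      then show ?thesis using Fin_fin_part[OF sig True] ij k(2) by (metis less_eq_extended.simps(1) restrict_apply' s_def)
    next
      case False
      then show ?thesis using ij by (simp add: sparsity_pattern_def less_le)
    qed
  next
    fix x assume "x \<in> T"
    then obtain i where i: "i \<in> X" "x = (i, t i)" using Tt by blast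
    have "t i \<in> Y" using t i(1) by (auto simp: bij_betw_def)
    moreover have "\<sigma> i (t i) = Fin (s i i)" unfolding s_def
      using TS(2) \<open>x \<in> T\<close> i(2) by (intro Fin_fin_part[OF sig]) auto
    ultimately show "case x of (i, j) \<Rightarrow> Fin (restrict d Y j - restrict c X i) = \<sigma> i j"
      using i dt[OF i(1)] by simp
  qed auto
  then show ?thesis by blast
qed

section \<open>Highest-value transversals of sub-matrices\<close>

lemma signature_matrix_subset:
  assumes "signature_matrix X Y \<sigma>" "X' \<subseteq> X" "Y' \<subseteq> Y" "card X' = card Y'"
  shows "signature_matrix X' Y' \<sigma>"
  using assms unfolding signature_matrix_def by (meson finite_subset subsetD)

text \<open>Exchange argument: \<open>T\<close> is the union of its parts on
  \<open>X' \<times> Y'\<close> and on the complementary rows and columns. A better transversal of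
  the sub-matrix, glued to the second part, would beat \<open>T\<close>.\<close>

lemma HVT_restrict:
  assumes sig: "signature_matrix X Y \<sigma>" and swp: "structurally_well_posed X Y \<sigma>"
    and T: "HVT X Y \<sigma> T" and sub: "X' \<subseteq> X" "Y' \<subseteq> Y"
    and closed: "\<And>i j. (i, j) \<in> T \<Longrightarrow> i \<in> X' \<longleftrightarrow> j \<in> Y'"
  shows "signature_matrix X' Y' \<sigma>" "structurally_well_posed X' Y' \<sigma>" "HVT X' Y' \<sigma> (T \<inter> X' \<times> Y')"
proof -
  have tv: "transversal X Y T" and TS: "T \<subseteq> sparsity_pattern X Y \<sigma>"
    and opt: "\<And>T'. transversal X Y T' \<Longrightarrow> T' \<subseteq> sparsity_pattern X Y \<sigma> \<Longrightarrow> finite_value \<sigma> T' \<le> finite_value \<sigma> T"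
    using T HVT_iff[OF sig swp] by blast+
  have fin: "finite T" using transversal_finite[OF tv] sig by (simp add: signature_matrix_def)
  let ?T1 = "T \<inter> X' \<times> Y'" and ?T2 = "T \<inter> (X - X') \<times> (Y - Y')"
  have t1: "transversal X' Y' ?T1" using tv sub closed by (rule transversal_restrict)
  have t2: "transversal (X - X') (Y - Y') ?T2"
    using tv by (rule transversal_restrict) (use closed transversal_subset[OF tv] in blast)+
  have T_split: "T = ?T1 \<union> ?T2" using closed transversal_subset[OF tv] by blast
  show sig': "signature_matrix X' Y' \<sigma>"
    using sig sub transversal_card[OF t1] by (rule signature_matrix_subset)
  have S1: "?T1 \<subseteq> sparsity_pattern X' Y' \<sigma>" using TS by (auto simp: sparsity_pattern_def)
  then show swp': "structurally_well_posed X' Y' \<sigma>" using t1 structurally_well_posed_iff by blast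
  have "finite_value \<sigma> T' \<le> finite_value \<sigma> ?T1"
    if T': "transversal X' Y' T'" "T' \<subseteq> sparsity_pattern X' Y' \<sigma>" for T'
  proof -
    have "transversal (X' \<union> (X - X')) (Y' \<union> (Y - Y')) (T' \<union> ?T2)"
      using T'(1) t2 by (rule transversal_Un) auto
    then have "transversal X Y (T' \<union> ?T2)" using sub by (simp add: Un_absorb1)
    moreover have "T' \<union> ?T2 \<subseteq> sparsity_pattern X Y \<sigma>"
      using T'(2) TS sub by (auto simp: sparsity_pattern_def)
    ultimately have "finite_value \<sigma> (T' \<union> ?T2) \<le> finite_value \<sigma> (?T1 \<union> ?T2)"
      using opt T_split by metis
    moreover have "finite_value \<sigma> (U \<union> ?T2) = finite_value \<sigma> U + finite_value \<sigma> ?T2"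
      if "finite U" "U \<subseteq> X' \<times> Y'" for U
      unfolding finite_value_def by (rule sum.union_disjoint) (use that fin in auto)
    moreover have "finite T'" using transversal_finite[OF T'(1)] sig' by (simp add: signature_matrix_def)
    ultimately show ?thesis using fin transversal_subset[OF T'(1)] by simp
  qed
  then show "HVT X' Y' \<sigma> ?T1" using HVT_iff[OF sig' swp'] t1 S1 by blast
qed


section \<open>Offset vectors on the essential pattern\<close>

lemma offset_pair_le:
  "general_offset_pair X Y \<sigma> c d \<Longrightarrow> i \<in> X \<Longrightarrow> j \<in> Y \<Longrightarrow> \<sigma> i j \<le> Fin (d j - c i)"
  by (simp add: general_offset_pair_def)

lemma offset_pairE:
  assumes "general_offset_pair X Y \<sigma> c d"
  obtains T where "HVT X Y \<sigma> T" "\<And>i j. (i, j) \<in> T \<Longrightarrow> Fin (d j - c i) = \<sigma> i j"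
proof -
  obtain T where T: "HVT X Y \<sigma> T" "\<forall>(i, j)\<in>T. Fin (d j - c i) = \<sigma> i j"
    using assms unfolding general_offset_pair_def by blast
  then show thesis by (intro that[of T]) auto
qed

text \<open>Over any transversal \<open>d j - c i\<close> sums to \<open>sum d Y - sum c X\<close>.
  This bounds the values of transversals in the sparsity pattern and is attained by the HVT that
  witnesses the offset pair, hence by every HVT; a termwise inequality whose sums agree is a
  termwise equality.\<close>

lemma offset_pair_tight:
  assumes sig: "signature_matrix X Y \<sigma>" and swp: "structurally_well_posed X Y \<sigma>"
    and cd: "general_offset_pair X Y \<sigma> c d" and ij: "(i, j) \<in> essential_pattern X Y \<sigma>"
  shows "\<sigma> i j = Fin (d j - c i)"
proof -
  obtain T where T: "HVT X Y \<sigma> T" "(i, j) \<in> T" using ij by (auto simp: essential_pattern_def)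
  obtain T0 where T0: "HVT X Y \<sigma> T0" and tight0: "\<And>i j. (i, j) \<in> T0 \<Longrightarrow> Fin (d j - c i) = \<sigma> i j"
    using cd by (rule offset_pairE) blast
  have tv: "transversal X Y T" "T \<subseteq> sparsity_pattern X Y \<sigma>" "transversal X Y T0"
    "T0 \<subseteq> sparsity_pattern X Y \<sigma>" "finite_value \<sigma> T0 \<le> finite_value \<sigma> T"
    using T(1) T0 HVT_iff[OF sig swp] by blast+
  have dual: "(\<Sum>(i, j)\<in>U. d j - c i) = sum d Y - sum c X" if "transversal X Y U" for U
    using transversal_sum_fst[OF that, of c] transversal_sum_snd[OF that, of d]
    by (simp add: case_prod_beta sum_subtractf)
  have le: "fin_part (\<sigma> i j) \<le> d j - c i" if "(i, j) \<in> T" for i j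
    using offset_pair_le[OF cd, of i j] Fin_fin_part[OF sig, of i j] that tv(1,2) transversal_subset
    by (metis less_eq_extended.simps(1) mem_Sigma_iff subsetD)
  have "finite_value \<sigma> T0 = (\<Sum>(i, j)\<in>T0. d j - c i)"
    unfolding finite_value_def
    by (rule sum.cong) (use tight0 in \<open>auto, metis fin_part.simps(1)\<close>)
  also have "\<dots> = (\<Sum>(i, j)\<in>T. d j - c i)" using dual tv(1,3) by simp
  finally have "(\<Sum>(i, j)\<in>T. d j - c i) \<le> finite_value \<sigma> T" using tv(5) by simp
  moreover have "finite_value \<sigma> T \<le> (\<Sum>(i, j)\<in>T. d j - c i)"
    unfolding finite_value_def by (rule sum_mono) (use le in auto)
  ultimately have "(\<Sum>x\<in>T. case_prod (\<lambda>i j. fin_part (\<sigma> i j)) x) = (\<Sum>x\<in>T. case_prod (\<lambda>i j. d j - c i) x)"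
    by (simp add: finite_value_def)
  then have "case_prod (\<lambda>i j. fin_part (\<sigma> i j)) (i, j) = case_prod (\<lambda>i j. d j - c i) (i, j)"
    by (rule sum_mono_inv)
      (use le T(2) transversal_finite[OF tv(1)] sig in \<open>auto simp: signature_matrix_def\<close>)
  then show ?thesis using Fin_fin_part[OF sig, of i j] T(2) tv(2) by auto
qed

text \<open>The HVT on which \<open>c\<close> and \<open>d\<close> are given as tight may differ
  from \<open>T\<close>; tightness on every HVT carries over to \<open>T\<close>, and so to its part
  inside the sub-matrix.\<close>

lemma offset_pair_restrict:
  assumes cd: "general_offset_pair X Y \<sigma> c d" and sub: "X' \<subseteq> X" "Y' \<subseteq> Y"
    and sig: "signature_matrix X Y \<sigma>" and swp: "structurally_well_posed X Y \<sigma>"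
    and T: "HVT X Y \<sigma> T" "HVT X' Y' \<sigma> (T \<inter> X' \<times> Y')"
  shows "general_offset_pair X' Y' \<sigma> (restrict c X') (restrict d Y')"
  unfolding general_offset_pair_def
proof (intro conjI exI[of _ "T \<inter> X' \<times> Y'"] T(2) ballI)
  show "\<sigma> i j \<le> Fin (restrict d Y' j - restrict c X' i)" if "i \<in> X'" "j \<in> Y'" for i j
    using offset_pair_le[OF cd, of i j] that sub by auto
  fix x assume "x \<in> T \<inter> X' \<times> Y'"
  moreover from this have "case x of (i, j) \<Rightarrow> \<sigma> i j = Fin (d j - c i)"
    using offset_pair_tight[OF sig swp cd] T(1) by (auto simp: essential_pattern_def)
  ultimately show "case x of (i, j) \<Rightarrow> Fin (restrict d Y' j - restrict c X' i) = \<sigma> i j" by auto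
qed auto


section \<open>Block-triangular forms\<close>

lemma block_positions_subset:
  assumes "l \<in> {1..p}"
  shows "block_positions N l \<subseteq> {1..\<Sum>r\<in>{1..p}. N r}"
proof -
  have "(\<Sum>r\<in>{1..l}. N r) \<le> (\<Sum>r\<in>{1..p}. N r)"
    by (rule sum_mono2) (use assms in auto)
  then show ?thesis by (auto simp: block_positions_def)
qed

lemma ex_block_position:
  assumes "x \<in> {1..\<Sum>r\<in>{1..p}. N r}"
  shows "\<exists>l\<in>{1..p}. x \<in> block_positions N l"
  using assms
proof (induction p)
  case (Suc p)
  show ?case
  proof (cases "x \<le> (\<Sum>r\<in>{1..p}. N r)")
    case True
    then show ?thesis using Suc by fastforce
  next
    case False
    then have "x \<in> block_positions N (Suc p)"
      using Suc.prems by (simp add: block_positions_def atLeastLessThanSuc_atLeastAtMost)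
    then show ?thesis by auto
  qed
qed simp

lemma block_positions_unique:
  assumes "x \<in> block_positions N k" "x \<in> block_positions N l"
  shows "k = l"
proof -
  have "\<not> k < l" if "x \<in> block_positions N k" "x \<in> block_positions N l" for k l
  proof
    assume "k < l"
    then have "(\<Sum>r\<in>{1..k}. N r) \<le> (\<Sum>r\<in>{1..<l}. N r)" by (intro sum_mono2) auto
    then show False using that by (auto simp: block_positions_def)
  qed
  then show ?thesis using assms by (meson linorder_neqE_nat)
qed

lemma block_positions_nonempty:
  assumes "l \<ge> 1" "N l > 0"
  shows "block_positions N l \<noteq> {}"
proof -
  have "{1..l} = insert l {1..<l}" using assms(1) by auto
  then have "(\<Sum>r\<in>{1..l}. N r) \<in> block_positions N l"
    using assms(2) by (simp add: block_positions_def)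
  then show ?thesis by blast
qed

text \<open>Every position of a pattern in block-triangular form has its row block at most its column block.
  Summed over a transversal the two block indices agree, since corresponding row and column blocks
  have equal size.\<close>

lemma transversal_in_diagonal_blocks:
  assumes form: "permuted_block_form X Y p N \<rho> \<kappa>" and btf: "puts_into_BTF p N \<rho> \<kappa> A"
    and fin: "finite X" and T: "transversal X Y T" "T \<subseteq> A" and ij: "(i, j) \<in> T" and l: "l \<in> {1..p}"
  shows "i \<in> \<rho> ` block_positions N l \<longleftrightarrow> j \<in> \<kappa> ` block_positions N l"
proof -
  have card: "card X = card Y" using transversal_card[OF T(1)] .
  let ?P = "{1..card X}"
  have \<rho>: "bij_betw \<rho> ?P X" and \<kappa>: "bij_betw \<kappa> ?P Y" and sumN: "(\<Sum>r\<in>{1..p}. N r) = card X"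
    using form card by (auto simp: permuted_block_form_def)
  define b where "b x = (THE l. l \<in> {1..p} \<and> x \<in> block_positions N l)" for x
  have b: "b x = l \<longleftrightarrow> x \<in> block_positions N l" if x: "x \<in> ?P" and l: "l \<in> {1..p}" for x l
  proof -
    obtain k where k: "k \<in> {1..p}" "x \<in> block_positions N k"
      using ex_block_position[of x N p] x sumN by metis
    then have "b x = k" unfolding b_def using block_positions_unique by (intro the_equality) blast+
    then show ?thesis using k block_positions_unique l by blast
  qed
  have b_mem: "b x \<in> {1..p}" if "x \<in> ?P" for x
    using ex_block_position[of x N p] b[OF that] that sumN by metis
  define f where "f i = b (inv_into ?P \<rho> i)" for i
  define g where "g j = b (inv_into ?P \<kappa> j)" for j
  have f: "f (\<rho> x) = b x" and g: "g (\<kappa> x) = b x" if "x \<in> ?P" for x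
    using \<rho> \<kappa> that by (simp_all add: f_def g_def bij_betw_inv_into_left)
  have f_iff: "f i = l \<longleftrightarrow> i \<in> \<rho> ` block_positions N l" if il: "i \<in> X" "l \<in> {1..p}" for i l
  proof -
    obtain x where x: "x \<in> ?P" "i = \<rho> x" using bij_betw_imp_surj_on[OF \<rho>] il(1) by blast
    have "i \<in> \<rho> ` block_positions N l \<longleftrightarrow> x \<in> block_positions N l"
      using x inj_on_image_mem_iff[of \<rho> ?P x "block_positions N l"] \<rho> block_positions_subset[OF il(2), of N, unfolded sumN]
      by (simp add: bij_betw_def)
    then show ?thesis using f x b il(2) by simp
  qed
  have g_iff: "g j = l \<longleftrightarrow> j \<in> \<kappa> ` block_positions N l" if jl: "j \<in> Y" "l \<in> {1..p}" for j l
  proof -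
    obtain x where x: "x \<in> ?P" "j = \<kappa> x" using bij_betw_imp_surj_on[OF \<kappa>] jl(1) by blast
    have "j \<in> \<kappa> ` block_positions N l \<longleftrightarrow> x \<in> block_positions N l"
      using x inj_on_image_mem_iff[of \<kappa> ?P x "block_positions N l"] \<kappa> block_positions_subset[OF jl(2), of N, unfolded sumN]
      by (simp add: bij_betw_def)
    then show ?thesis using g x b jl(2) by simp
  qed
  have mem: "f i \<in> {1..p}" "g j \<in> {1..p}" if "i \<in> X" "j \<in> Y" for i j
    using bij_betw_apply[OF bij_betw_inv_into[OF \<rho>] that(1)]
      bij_betw_apply[OF bij_betw_inv_into[OF \<kappa>] that(2)] b_mem
    by (simp_all only: f_def g_def)
  have le: "f i \<le> g j" if "(i, j) \<in> T" for i j
  proof (rule ccontr)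
    assume "\<not> f i \<le> g j"
    then have gt: "f i > g j" by simp
    have XY: "i \<in> X" "j \<in> Y" using that T(1) transversal_subset by blast+
    have "i \<in> \<rho> ` block_positions N (f i)" "j \<in> \<kappa> ` block_positions N (g j)"
      using f_iff[OF XY(1) mem(1)[OF XY]] g_iff[OF XY(2) mem(2)[OF XY]] by blast+
    moreover have "A \<inter> \<rho> ` block_positions N (f i) \<times> \<kappa> ` block_positions N (g j) = {}"
      using btf mem[OF XY] gt by (simp add: puts_into_BTF_def)
    ultimately show False using that T(2) by blast
  qed
  have "(\<Sum>(i, j)\<in>T. f i) = (\<Sum>x\<in>?P. b x)"
    using transversal_sum_fst[OF T(1), of f] sum.reindex_bij_betw[OF \<rho>, of f] f by simp
  also have "\<dots> = (\<Sum>(i, j)\<in>T. g j)"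
    using transversal_sum_snd[OF T(1), of g] sum.reindex_bij_betw[OF \<kappa>, of g] g by simp
  finally have "(\<Sum>x\<in>T. case_prod (\<lambda>i j. f i) x) = (\<Sum>x\<in>T. case_prod (\<lambda>i j. g j) x)" .
  then have "case_prod (\<lambda>i j. f i) (i, j) = case_prod (\<lambda>i j. g j) (i, j)"
    by (rule sum_mono_inv) (use le ij transversal_finite[OF T(1) fin] in auto)
  then show ?thesis using f_iff[OF _ l, of i] g_iff[OF _ l, of j] ij transversal_subset[OF T(1)] by auto
qed

text \<open>Blocks of a permuted form occupy consecutive positions, so a set that is to become the
  leading block has to be listed first.\<close>

lemma ex_bij_betw_initial_segment:
  assumes "finite X" "X' \<subseteq> X"
  shows "\<exists>\<rho>. bij_betw \<rho> {1..card X} X \<and> \<rho> ` {1..card X'} = X'"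
proof -
  have fin: "finite X'" "finite (X - X')" using assms by (auto intro: finite_subset)
  have le: "card X' \<le> card X" using assms by (rule card_mono)
  obtain f where f: "bij_betw f {1..card X'} X'" using ex_bij_betw_nat_finite_1[OF fin(1)] by blast
  have "card {card X' + 1..card X} = card (X - X')" using card_Diff_subset[OF fin(1) assms(2)] by simp
  then obtain g where g: "bij_betw g {card X' + 1..card X} (X - X')"
    using finite_same_card_bij fin(2) by blast
  let ?\<rho> = "\<lambda>x. if x \<in> {1..card X'} then f x else g x"
  have "bij_betw ?\<rho> ({1..card X'} \<union> {card X' + 1..card X}) (X' \<union> (X - X'))"
    using f g by (rule bij_betw_disjoint_Un) auto
  moreover have "{1..card X'} \<union> {card X' + 1..card X} = {1..card X}" using le by auto
  moreover have "X' \<union> (X - X') = X" using assms(2) by blast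
  moreover have "?\<rho> ` {1..card X'} = X'" using f by (auto simp: bij_betw_def)
  ultimately show ?thesis by metis
qed

text \<open>If \<open>X'\<close> were proper, listing \<open>X'\<close> and \<open>Y'\<close> first
  would give two non-empty square blocks. The region below the diagonal is then
  \<open>(X - X') \<times> Y'\<close>, which \<open>A\<close> avoids, against
  irreducibility.\<close>

lemma irreducible_pattern_no_zero_block:
  assumes irr: "irreducible_pattern X Y A" and fin: "finite X" "finite Y"
    and sub: "X' \<subseteq> X" "Y' \<subseteq> Y" and card': "card X' = card Y'"
    and zero: "A \<inter> (X - X') \<times> Y' = {}" and ne: "X' \<noteq> {}"
  shows "X' = X"
proof (rule ccontr)
  assume "X' \<noteq> X"
  with fin(1) sub(1) have lt: "card X' < card X" by (simp add: psubset_card_mono psubset_eq)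
  have pos: "card X' > 0" using ne sub(1) fin(1) by (meson card_gt_0_iff finite_subset)
  have card: "card X = card Y" using irr transversal_card by (auto simp: irreducible_pattern_def)
  obtain \<rho> where \<rho>: "bij_betw \<rho> {1..card X} X" "\<rho> ` {1..card X'} = X'"
    using ex_bij_betw_initial_segment[OF fin(1) sub(1)] by blast
  obtain \<kappa> where \<kappa>: "bij_betw \<kappa> {1..card Y} Y" "\<kappa> ` {1..card Y'} = Y'"
    using ex_bij_betw_initial_segment[OF fin(2) sub(2)] by blast
  define N where "N l = (if l = 1 then card X' else card X - card X')" for l :: nat
  have two: "{1..2} = {1, 2 :: nat}" "{1..<2} = {1 :: nat}" by auto
  have sumN: "(\<Sum>l\<in>{1..2}. N l) = card X" using lt unfolding two(1) by (simp add: N_def)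
  have B: "block_positions N 1 = {1..card X'}" "block_positions N 2 = {1..card X} - {1..card X'}"
    using sumN by (auto simp: block_positions_def two(2) N_def)
  have "\<rho> ` block_positions N 2 = X - X'"
    using \<rho> lt by (simp add: B(2) bij_betw_def inj_on_image_set_diff[of \<rho> "{1..card X}"])
  then have "puts_into_BTF 2 N \<rho> \<kappa> A"
    using \<kappa>(2) zero card' unfolding puts_into_BTF_def two(1) by (simp add: B(1)[unfolded One_nat_def])
  moreover have "permuted_block_form X Y 2 N \<rho> \<kappa>"
    using \<rho>(1) \<kappa>(1) sumN lt pos by (auto simp: permuted_block_form_def N_def)
  ultimately show False using irr unfolding irreducible_pattern_def by (metis one_less_numeral_iff semiring_norm(76))
qed

text \<open>A level set of the labelling would otherwise be a diagonal block of a block-triangular form.\<close>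

lemma irreducible_pattern_labels_eq:
  assumes irr: "irreducible_pattern X Y A" and fin: "finite X" "finite Y"
    and lab: "\<And>i j. (i, j) \<in> A \<Longrightarrow> e i = f j"
    and ik: "i \<in> X"
  shows "k \<in> X \<Longrightarrow> e k = e i" "j \<in> Y \<Longrightarrow> f j = e i"
proof -
  obtain T where T: "transversal X Y T" "T \<subseteq> A" using irr by (auto simp: irreducible_pattern_def)
  have labT: "e i = f j" if "(i, j) \<in> T" for i j using that T(2) lab by blast
  let ?X = "{x \<in> X. e x = e i}" and ?Y = "{y \<in> Y. f y = e i}"
  \<comment> \<open>Labels agree along \<open>T\<close>, so \<open>T\<close> matches the rows and
    the columns with label \<open>e i\<close>. This makes the level set square, as a diagonal block
    must be.\<close>
  have "transversal ?X ?Y (T \<inter> ?X \<times> ?Y)"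
    by (rule transversal_restrict[OF T(1)]) (use labT transversal_subset[OF T(1)] in auto)
  then have "card ?X = card ?Y" by (rule transversal_card)
  moreover have "A \<inter> (X - ?X) \<times> ?Y = {}" using lab by auto
  ultimately have X: "?X = X"
    using irreducible_pattern_no_zero_block[OF irr fin, of ?X ?Y] ik by blast
  then show "e k = e i" if "k \<in> X" using that by blast
  show "f j = e i" if "j \<in> Y"
  proof -
    obtain k where "k \<in> X" "(k, j) \<in> T" using transversal_column[OF T(1) \<open>j \<in> Y\<close>] by blast
    then show ?thesis using labT X by force
  qed
qed


section \<open>Canonical offsets of an irreducible block\<close>

text \<open>\<open>A\<close> is a parameter because irreducibility of a fine block concerns the
  trace of the essential pattern of the whole matrix. Lying inside the essential pattern of the
  block is enough for both offset pairs to be tight on \<open>A\<close>, so that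
  \<open>c - c'\<close> and \<open>d - d'\<close> are matching labels.\<close>

lemma irreducible_offset_difference:
  assumes sig: "signature_matrix X Y \<sigma>" and swp: "structurally_well_posed X Y \<sigma>"
    and irr: "irreducible_pattern X Y A" and A: "A \<subseteq> essential_pattern X Y \<sigma>"
    and cd: "general_offset_pair X Y \<sigma> c d" "general_offset_pair X Y \<sigma> c' d'" and i: "i \<in> X"
  shows "k \<in> X \<Longrightarrow> c k - c' k = c i - c' i" "j \<in> Y \<Longrightarrow> d j - d' j = c i - c' i"
proof -
  have fin: "finite X" "finite Y" using sig by (auto simp: signature_matrix_def)
  have lab: "c i - c' i = d j - d' j" if "(i, j) \<in> A" for i j
  proof -
    have "(i, j) \<in> essential_pattern X Y \<sigma>" using that A by blast
    then have "Fin (d j - c i) = Fin (d' j - c' i)"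
      using offset_pair_tight[OF sig swp cd(1)] offset_pair_tight[OF sig swp cd(2)] by metis
    then show ?thesis by simp
  qed
  note * = irreducible_pattern_labels_eq[OF irr fin, of "\<lambda>i. c i - c' i" "\<lambda>j. d j - d' j", OF lab i]
  show "k \<in> X \<Longrightarrow> c k - c' k = c i - c' i" "j \<in> Y \<Longrightarrow> d j - d' j = c i - c' i"
    using * by blast+
qed

lemma offset_pair_shift:
  assumes "general_offset_pair X Y \<sigma> c d"
  shows "general_offset_pair X Y \<sigma> (\<lambda>i\<in>X. c i + m) (\<lambda>j\<in>Y. d j + m)"
proof -
  obtain T where T: "HVT X Y \<sigma> T" "\<And>i j. (i, j) \<in> T \<Longrightarrow> Fin (d j - c i) = \<sigma> i j"
    using assms by (rule offset_pairE) blast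
  have "T \<subseteq> X \<times> Y" using T(1) by (simp add: HVT_def transversal_def)
  then show ?thesis
    using T offset_pair_le[OF assms] unfolding general_offset_pair_def
    by (intro conjI exI[of _ T]) auto
qed

text \<open>Once the least entry is shifted to 0, at row \<open>i0\<close>, any valid competitor
  \<open>c'\<close> exceeds \<open>c\<close> by the constant \<open>c' i0\<close>, which validity
  makes nonnegative. The same constant governs the column offsets, so the pair is determined by its
  row part.\<close>

lemma canonical_offsets_irreducible:
  assumes sig: "signature_matrix X Y \<sigma>" and swp: "structurally_well_posed X Y \<sigma>"
    and irr: "irreducible_pattern X Y A" and A: "A \<subseteq> essential_pattern X Y \<sigma>" and ne: "X \<noteq> {}"
  shows "general_offset_pair X Y \<sigma> (canonical_c X Y \<sigma>) (canonical_d X Y \<sigma>) \<and> valid X (canonical_c X Y \<sigma>)"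
proof -
  let ?canonical = "\<lambda>(c, d). general_offset_pair X Y \<sigma> c d \<and> valid X c \<and>
     (\<forall>c'\<in>general_offset_vectors X Y \<sigma>. valid X c' \<longrightarrow> (\<forall>i\<in>X. c i \<le> c' i))"
  note diff = irreducible_offset_difference[OF sig swp irr A]
  obtain c0 d0 where cd0: "general_offset_pair X Y \<sigma> c0 d0" using ex_general_offset_pair[OF sig swp] by blast
  have fin: "finite X" using sig by (simp add: signature_matrix_def)
  obtain i0 where i0: "i0 \<in> X" "\<And>i. i \<in> X \<Longrightarrow> c0 i0 \<le> c0 i"
    using ex_min_if_finite[of "c0 ` X"] fin ne by (metis (no_types, lifting) finite_imageI imageE image_eqI image_is_empty linorder_not_le)
  define c where "c = (\<lambda>i\<in>X. c0 i + - c0 i0)"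
  define d where "d = (\<lambda>j\<in>Y. d0 j + - c0 i0)"
  have cd: "general_offset_pair X Y \<sigma> c d" unfolding c_def d_def by (rule offset_pair_shift[OF cd0])
  have c0: "c i0 = 0" using i0(1) by (simp add: c_def)
  have canon: "?canonical (c, d)"
  proof (clarsimp, intro conjI ballI impI cd)
    show "valid X c" using i0 by (auto simp: valid_def c_def)
    fix c' i assume c': "c' \<in> general_offset_vectors X Y \<sigma>" "valid X c'" and i: "i \<in> X"
    then obtain d' where "general_offset_pair X Y \<sigma> c' d'" by (auto simp: general_offset_vectors_def)
    moreover have "0 \<le> c' i0" using c'(2) i0(1) by (simp add: valid_def)
    ultimately show "c i \<le> c' i" using diff(1)[OF cd _ i0(1) i] c0 by fastforce
  qed
  have "x = (c, d)" if "?canonical x" for x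
  proof (cases x)
    case (Pair c' d')
    with that have c': "general_offset_pair X Y \<sigma> c' d'" "valid X c'"
      and min: "\<And>c''. c'' \<in> general_offset_vectors X Y \<sigma> \<Longrightarrow> valid X c'' \<Longrightarrow> \<forall>i\<in>X. c' i \<le> c'' i"
      by auto
    \<comment> \<open>Uniqueness is decided at one row: minimality gives
      \<open>c' i0 \<le> 0\<close> and validity gives \<open>c' i0 \<ge> 0\<close>, so the constant
      difference vanishes.\<close>
    have "c' i0 \<le> c i0" using min[of c] canon i0(1) by (auto simp: general_offset_vectors_def)
    then have "c' i0 = c i0" using c'(2) i0(1) c0 by (auto simp: valid_def)
    then have "\<And>i. i \<in> X \<Longrightarrow> c' i = c i" "\<And>j. j \<in> Y \<Longrightarrow> d' j = d j"
      using diff[OF c'(1) cd i0(1)] by auto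
    moreover have "c' \<in> int_vectors X" "c \<in> int_vectors X" "d' \<in> int_vectors Y" "d \<in> int_vectors Y"
      using c'(1) cd by (auto simp: general_offset_pair_def)
    ultimately show ?thesis using Pair by (auto intro: PiE_ext)
  qed
  then have "canonical_offsets X Y \<sigma> = (c, d)"
    unfolding canonical_offsets_def using canon by (rule the_equality[rotated])
  then show ?thesis using canon by simp
qed

section \<open>Fine blocks\<close>

text \<open>The emblem comes from some block-triangular form with its own indices
  \<open>1..q\<close>; the enumeration matches them bijectively but in any order. These facts hold
  for either indexing and are all that the theorem takes from the form.\<close>

lemma fine_blocks:
  fixes n :: nat and \<sigma> :: sigmat
  defines "A \<equiv> essential_pattern {1..n} {1..n} \<sigma>"
  assumes "fine_block_enumeration n \<sigma> p R C"
  shows "\<And>l. l \<in> {1..p} \<Longrightarrow> R l \<subseteq> {1..n} \<and> C l \<subseteq> {1..n} \<and> R l \<noteq> {}"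
    and "\<And>l. l \<in> {1..p} \<Longrightarrow> irreducible_pattern (R l) (C l) (A \<inter> R l \<times> C l)"
    and "\<And>i. i \<in> {1..n} \<Longrightarrow> \<exists>l\<in>{1..p}. i \<in> R l"
    and "\<And>j. j \<in> {1..n} \<Longrightarrow> \<exists>l\<in>{1..p}. j \<in> C l"
    and "\<And>i k l. k \<in> {1..p} \<Longrightarrow> l \<in> {1..p} \<Longrightarrow> i \<in> R k \<Longrightarrow> i \<in> R l \<Longrightarrow> k = l"
    and "\<And>j k l. k \<in> {1..p} \<Longrightarrow> l \<in> {1..p} \<Longrightarrow> j \<in> C k \<Longrightarrow> j \<in> C l \<Longrightarrow> k = l"
    and "\<And>T i j l. HVT {1..n} {1..n} \<sigma> T \<Longrightarrow> (i, j) \<in> T \<Longrightarrow> l \<in> {1..p} \<Longrightarrow> i \<in> R l \<longleftrightarrow> j \<in> C l"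
proof -
  obtain q N \<rho> \<kappa> where btf: "irreducible_BTF {1..n} {1..n} A q N \<rho> \<kappa>"
    and bij: "bij_betw (\<lambda>l. (R l, C l)) {1..p}
      ((\<lambda>l. (\<rho> ` block_positions N l, \<kappa> ` block_positions N l)) ` {1..q})"
    using assms unfolding fine_block_enumeration_def is_irreducible_emblem_def by blast
  have form: "permuted_block_form {1..n} {1..n} q N \<rho> \<kappa>" and put: "puts_into_BTF q N \<rho> \<kappa> A"
    and irr: "\<And>m. m \<in> {1..q} \<Longrightarrow> irreducible_pattern (\<rho> ` block_positions N m) (\<kappa> ` block_positions N m)
      (A \<inter> \<rho> ` block_positions N m \<times> \<kappa> ` block_positions N m)"
    using btf unfolding irreducible_BTF_def Let_def by auto
  have \<rho>: "bij_betw \<rho> {1..n} {1..n}" and \<kappa>: "bij_betw \<kappa> {1..n} {1..n}"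
    and N: "\<And>m. m \<in> {1..q} \<Longrightarrow> N m > 0" and sumN: "(\<Sum>r\<in>{1..q}. N r) = n"
    using form by (auto simp: permuted_block_form_def)
  have B: "block_positions N m \<subseteq> {1..n}" "block_positions N m \<noteq> {}" if "m \<in> {1..q}" for m
    using block_positions_subset[OF that, of N] block_positions_nonempty[of m N] N[OF that] sumN that by auto
  have from_l: "\<exists>m\<in>{1..q}. R l = \<rho> ` block_positions N m \<and> C l = \<kappa> ` block_positions N m"
    if "l \<in> {1..p}" for l
    using bij_betw_apply[OF bij that] by auto
  have from_m: "\<exists>l\<in>{1..p}. R l = \<rho> ` block_positions N m \<and> C l = \<kappa> ` block_positions N m"
    if m: "m \<in> {1..q}" for m
  proof -
    have "(\<rho> ` block_positions N m, \<kappa> ` block_positions N m) \<in> (\<lambda>l. (R l, C l)) ` {1..p}"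
      unfolding bij_betw_imp_surj_on[OF bij] using m by blast
    then obtain l where "(\<rho> ` block_positions N m, \<kappa> ` block_positions N m) = (R l, C l)" "l \<in> {1..p}"
      by (rule imageE)
    then show ?thesis by (intro bexI[of _ l]) auto
  qed
  show "R l \<subseteq> {1..n} \<and> C l \<subseteq> {1..n} \<and> R l \<noteq> {}" if l: "l \<in> {1..p}" for l
  proof -
    obtain m where m: "m \<in> {1..q}" "R l = \<rho> ` block_positions N m" "C l = \<kappa> ` block_positions N m"
      using from_l[OF l] by blast
    have "\<rho> ` block_positions N m \<subseteq> \<rho> ` {1..n}" "\<kappa> ` block_positions N m \<subseteq> \<kappa> ` {1..n}"
      using B(1)[OF m(1)] by (simp_all add: image_mono)
    then show ?thesis using m B(2)[OF m(1)] \<rho> \<kappa> by (simp add: bij_betw_def)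
  qed
  show "irreducible_pattern (R l) (C l) (A \<inter> R l \<times> C l)" if l: "l \<in> {1..p}" for l
  proof -
    obtain m where m: "m \<in> {1..q}" "R l = \<rho> ` block_positions N m" "C l = \<kappa> ` block_positions N m"
      using from_l[OF l] by blast
    show ?thesis unfolding m(2,3) by (rule irr[OF m(1)])
  qed
  show "\<exists>l\<in>{1..p}. i \<in> R l" if i: "i \<in> {1..n}" for i
  proof -
    obtain x where x: "x \<in> {1..n}" "i = \<rho> x" using bij_betw_imp_surj_on[OF \<rho>] i by blast
    from x(1) sumN have "x \<in> {1..\<Sum>r\<in>{1..q}. N r}" by simp
    then obtain m where m: "m \<in> {1..q}" "x \<in> block_positions N m" using ex_block_position by blast
    then show ?thesis using from_m[OF m(1)] x(2) by blast
  qed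
  show "\<exists>l\<in>{1..p}. j \<in> C l" if j: "j \<in> {1..n}" for j
  proof -
    obtain x where x: "x \<in> {1..n}" "j = \<kappa> x" using bij_betw_imp_surj_on[OF \<kappa>] j by blast
    from x(1) sumN have "x \<in> {1..\<Sum>r\<in>{1..q}. N r}" by simp
    then obtain m where m: "m \<in> {1..q}" "x \<in> block_positions N m" using ex_block_position by blast
    then show ?thesis using from_m[OF m(1)] x(2) by blast
  qed
  have same: "m = m'" if mm: "m \<in> {1..q}" "m' \<in> {1..q}" "bij_betw f {1..n} {1..n}"
    "x \<in> f ` block_positions N m" "x \<in> f ` block_positions N m'" for m m' x and f :: "nat \<Rightarrow> nat"
  proof -
    obtain y y' where y: "y \<in> block_positions N m" "y' \<in> block_positions N m'" "f y = f y'"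
      using mm(4,5) by auto
    then have "y = y'" using B(1)[OF mm(1)] B(1)[OF mm(2)] mm(3)
      by (meson bij_betw_def inj_onD subsetD)
    then show ?thesis using y block_positions_unique by blast
  qed
  \<comment> \<open>The enumeration is injective on pairs only. A shared row or a shared column
    first forces the same block of the form, hence equal pairs, and then equal indices.\<close>
  have inj: "k = l" if "k \<in> {1..p}" "l \<in> {1..p}" "R k = R l" "C k = C l" for k l
    by (rule inj_onD[OF bij_betw_imp_inj_on[OF bij]]) (use that in simp_all)
  show "k = l" if kl: "k \<in> {1..p}" "l \<in> {1..p}" "i \<in> R k" "i \<in> R l" for i k l
  proof -
    obtain m m' where m: "m \<in> {1..q}" "R k = \<rho> ` block_positions N m" "C k = \<kappa> ` block_positions N m"
      using from_l[OF kl(1)] by blast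
    obtain m' where m': "m' \<in> {1..q}" "R l = \<rho> ` block_positions N m'" "C l = \<kappa> ` block_positions N m'"
      using from_l[OF kl(2)] by blast
    have "m = m'" using same[OF m(1) m'(1) \<rho>] kl(3,4) m m' by simp
    then show ?thesis using inj[OF kl(1,2)] m m' by simp
  qed
  show "k = l" if kl: "k \<in> {1..p}" "l \<in> {1..p}" "j \<in> C k" "j \<in> C l" for j k l
  proof -
    obtain m m' where m: "m \<in> {1..q}" "R k = \<rho> ` block_positions N m" "C k = \<kappa> ` block_positions N m"
      using from_l[OF kl(1)] by blast
    obtain m' where m': "m' \<in> {1..q}" "R l = \<rho> ` block_positions N m'" "C l = \<kappa> ` block_positions N m'"
      using from_l[OF kl(2)] by blast
    have "m = m'" using same[OF m(1) m'(1) \<kappa>] kl(3,4) m m' by simp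
    then show ?thesis using inj[OF kl(1,2)] m m' by simp
  qed
  show "i \<in> R l \<longleftrightarrow> j \<in> C l" if T: "HVT {1..n} {1..n} \<sigma> T" "(i, j) \<in> T" and l: "l \<in> {1..p}" for T i j l
  proof -
    obtain m where m: "m \<in> {1..q}" "R l = \<rho> ` block_positions N m" "C l = \<kappa> ` block_positions N m"
      using from_l[OF l] by blast
    have "transversal {1..n} {1..n} T" using T(1) by (simp add: HVT_def)
    moreover have "T \<subseteq> A" using T(1) by (auto simp: A_def essential_pattern_def)
    ultimately show ?thesis
      using transversal_in_diagonal_blocks[OF form put _ _ _ T(2) m(1)] m(2,3) by simp
  qed
qed

text \<open>A bound on the maximum bounds every member, and the finite offsets can be moved across.
  Off the sparsity pattern the entry is \<open>-\<infinity>\<close>, which also settles the empty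
  maximum. With \<open>m = K l - K k\<close> the right-hand side is the offset inequality for local
  offsets shifted by \<open>K\<close>.\<close>

lemma block_W_le_iff:
  assumes sig: "signature_matrix {1..n} {1..n} \<sigma>" and sub: "R k \<subseteq> {1..n}" "C l \<subseteq> {1..n}"
  shows "block_W n \<sigma> R C k l \<le> Fin m \<longleftrightarrow>
    (\<forall>i\<in>R k. \<forall>j\<in>C l. \<sigma> i j \<le> Fin (m + canonical_d (R l) (C l) \<sigma> j - canonical_c (R k) (C k) \<sigma> i))"
proof -
  let ?c = "canonical_c (R k) (C k) \<sigma>" and ?d = "canonical_d (R l) (C l) \<sigma>"
  define D where "D = sparsity_pattern {1..n} {1..n} \<sigma> \<inter> R k \<times> C l"
  define V where "V = {\<sigma> i j - Fin (?d j) + Fin (?c i) | i j. (i, j) \<in> D}"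
  have V: "V = (\<lambda>(i, j). \<sigma> i j - Fin (?d j) + Fin (?c i)) ` D" by (auto simp: V_def)
  have "finite (R k \<times> C l)" using sub by (meson finite_SigmaI finite_atLeastAtMost finite_subset)
  then have fin: "finite V" by (simp add: V D_def)
  have "block_W n \<sigma> R C k l = (if V = {} then -\<infinity> else Max V)"
    by (simp only: block_W_def V_def D_def Let_def)
  then have "block_W n \<sigma> R C k l \<le> Fin m \<longleftrightarrow> (\<forall>v\<in>V. v \<le> Fin m)" using fin by simp
  also have "\<dots> \<longleftrightarrow> (\<forall>(i, j)\<in>D. \<sigma> i j - Fin (?d j) + Fin (?c i) \<le> Fin m)"
    by (auto simp: V)
  also have "\<dots> \<longleftrightarrow> (\<forall>(i, j)\<in>D. \<sigma> i j \<le> Fin (m + ?d j - ?c i))"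
  proof (intro ball_cong refl, clarify)
    fix i j assume "(i, j) \<in> D"
    then obtain s where "\<sigma> i j = Fin s" using Fin_fin_part[OF sig, of i j] by (auto simp: D_def)
    then show "\<sigma> i j - Fin (?d j) + Fin (?c i) \<le> Fin m \<longleftrightarrow> \<sigma> i j \<le> Fin (m + ?d j - ?c i)" by auto
  qed
  also have "\<dots> \<longleftrightarrow> (\<forall>i\<in>R k. \<forall>j\<in>C l. \<sigma> i j \<le> Fin (m + ?d j - ?c i))"
  proof -
    have "\<sigma> i j \<le> Fin u" if "i \<in> R k" "j \<in> C l" "(i, j) \<notin> D" for i j u
    proof -
      have "\<sigma> i j = -\<infinity>" using that sub by (auto simp: D_def sparsity_pattern_def less_le)
      then show ?thesis by simp
    qed
    moreover have "D \<subseteq> R k \<times> C l" by (simp add: D_def)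
    ultimately show ?thesis by blast
  qed
  finally show ?thesis .
qed

section \<open>General offset vectors as shifted local offsets\<close>

theorem theorem5p2:
  fixes n p :: nat and \<sigma> :: sigmat and R C :: "nat \<Rightarrow> nat set" and a :: "nat \<Rightarrow> nat"
  assumes "signature_matrix {1..n} {1..n} \<sigma>"
    and "structurally_well_posed {1..n} {1..n} \<sigma>"
    and "fine_block_enumeration n \<sigma> p R C"
    and "anchor_indices \<sigma> p R C a"
  shows "bij_betw (anchor_map p a)
           (general_offset_vectors {1..n} {1..n} \<sigma>) (block_solutions n \<sigma> p R C) \<and>
         (\<forall>c\<in>general_offset_vectors {1..n} {1..n} \<sigma>.
           valid {1..n} c \<longleftrightarrow> valid {1..p} (anchor_map p a c)) \<and>
         (\<forall>c\<in>general_offset_vectors {1..n} {1..n} \<sigma>.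
           normalised {1..n} c \<longleftrightarrow> normalised {1..p} (anchor_map p a c))"
proof -
  let ?X = "{1..n}" and ?P = "{1..p}"
  note sig = assms(1) and swp = assms(2)
  note blocks = fine_blocks[OF assms(3)]
  define c\<^sub>l where "c\<^sub>l l = canonical_c (R l) (C l) \<sigma>" for l
  define d\<^sub>l where "d\<^sub>l l = canonical_d (R l) (C l) \<sigma>" for l
  let ?A = "essential_pattern ?X ?X \<sigma>"
  \<comment> \<open>An offset pair needs to be tight on a single HVT only; this one serves for the
    whole matrix and, cut down, for every block.\<close>
  obtain T where T: "HVT ?X ?X \<sigma> T" using ex_HVT[OF sig swp] by blast
  have TX: "T \<subseteq> ?X \<times> ?X" using T by (simp add: HVT_def transversal_def)

  have restr: "signature_matrix (R l) (C l) \<sigma> \<and> structurally_well_posed (R l) (C l) \<sigma> \<and>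
    HVT (R l) (C l) \<sigma> (U \<inter> R l \<times> C l)" if l: "l \<in> ?P" and U: "HVT ?X ?X \<sigma> U" for l U
    using HVT_restrict[OF sig swp U _ _ blocks(7)[OF U _ l]] blocks(1)[OF l] by simp
  have local: "signature_matrix (R l) (C l) \<sigma>" "structurally_well_posed (R l) (C l) \<sigma>"
    "\<And>U. HVT ?X ?X \<sigma> U \<Longrightarrow> HVT (R l) (C l) \<sigma> (U \<inter> R l \<times> C l)" if l: "l \<in> ?P" for l
    using restr[OF l] T by blast+
  have ess: "?A \<inter> R l \<times> C l \<subseteq> essential_pattern (R l) (C l) \<sigma>" if l: "l \<in> ?P" for l
    using local(3)[OF l] unfolding essential_pattern_def by blast
  have canon: "general_offset_pair (R l) (C l) \<sigma> (c\<^sub>l l) (d\<^sub>l l) \<and> valid (R l) (c\<^sub>l l)" if l: "l \<in> ?P" for l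
    unfolding c\<^sub>l_def d\<^sub>l_def
    using canonical_offsets_irreducible[OF local(1,2)[OF l] blocks(2)[OF l] ess[OF l]] blocks(1)[OF l]
    by blast
  have anchor: "a l \<in> R l" "c\<^sub>l l (a l) = 0" if "l \<in> ?P" for l
    using assms(4) that by (auto simp: anchor_indices_def c\<^sub>l_def)

  \<comment> \<open>The constant by which the restriction of \<open>c\<close> exceeds
    \<open>c\<^sub>l l\<close> is read off at the anchor, where \<open>c\<^sub>l l\<close> is 0. The
    same constant shifts the columns.\<close>
  have split: "i \<in> R l \<Longrightarrow> c i = c (a l) + c\<^sub>l l i" "j \<in> C l \<Longrightarrow> d j = c (a l) + d\<^sub>l l j"
    if cd: "general_offset_pair ?X ?X \<sigma> c d" and l: "l \<in> ?P" for c d l i j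
  proof -
    have "general_offset_pair (R l) (C l) \<sigma> (restrict c (R l)) (restrict d (C l))"
      using offset_pair_restrict[OF cd _ _ sig swp T local(3)[OF l T]] blocks(1)[OF l] by blast
    note * = irreducible_offset_difference[OF local(1,2)[OF l] blocks(2)[OF l] ess[OF l] this
        conjunct1[OF canon[OF l]] anchor(1)[OF l]]
    show "c i = c (a l) + c\<^sub>l l i" if "i \<in> R l" using *(1)[OF that] that anchor[OF l] by simp
    show "d j = c (a l) + d\<^sub>l l j" if "j \<in> C l" using *(2)[OF that] that anchor[OF l] by simp
  qed
  have c_split: "c i = c (a l) + c\<^sub>l l i"
    if "c \<in> general_offset_vectors ?X ?X \<sigma>" "l \<in> ?P" "i \<in> R l" for c l i
    using that split(1) by (auto simp: general_offset_vectors_def)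
  have anchor_map: "anchor_map p a c l = c (a l)" if "l \<in> ?P" for c l
    using that by (simp add: anchor_map_def)
  have W_iff: "block_W n \<sigma> R C k l \<le> Fin m \<longleftrightarrow>
      (\<forall>i\<in>R k. \<forall>j\<in>C l. \<sigma> i j \<le> Fin (m + d\<^sub>l l j - c\<^sub>l k i))" if "k \<in> ?P" "l \<in> ?P" for k l m
    unfolding c\<^sub>l_def d\<^sub>l_def
    using block_W_le_iff[where R = R and C = C and k = k and l = l and m = m, OF sig]
      blocks(1)[OF that(1)] blocks(1)[OF that(2)] by blast

  have "bij_betw (anchor_map p a) (general_offset_vectors ?X ?X \<sigma>) (block_solutions n \<sigma> p R C)"
  proof (rule bij_betw_imageI)
    show "inj_on (anchor_map p a) (general_offset_vectors ?X ?X \<sigma>)"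
    proof (rule inj_onI)
      fix c c' assume c: "c \<in> general_offset_vectors ?X ?X \<sigma>" and c': "c' \<in> general_offset_vectors ?X ?X \<sigma>"
        and eq: "anchor_map p a c = anchor_map p a c'"
      have "c i = c' i" if i: "i \<in> ?X" for i
      proof -
        obtain l where l: "l \<in> ?P" "i \<in> R l" using blocks(3)[OF i] by blast
        then show ?thesis using c_split[OF c l] c_split[OF c' l] anchor_map[OF l(1)] eq by metis
      qed
      moreover have "c \<in> int_vectors ?X" "c' \<in> int_vectors ?X"
        using c c' by (auto simp: general_offset_vectors_def general_offset_pair_def)
      ultimately show "c = c'" by (auto intro: PiE_ext)
    qed
    show "anchor_map p a ` general_offset_vectors ?X ?X \<sigma> = block_solutions n \<sigma> p R C"
    proof (intro set_eqI iffI)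
      fix K assume "K \<in> anchor_map p a ` general_offset_vectors ?X ?X \<sigma>"
      then obtain c d where K: "K = anchor_map p a c" and cd: "general_offset_pair ?X ?X \<sigma> c d"
        by (auto simp: general_offset_vectors_def)
      have "block_W n \<sigma> R C k l \<le> Fin (K l - K k)" if kl: "k \<in> ?P" "l \<in> ?P" for k l
        unfolding W_iff[OF kl]
      proof (intro ballI)
        fix i j assume ij: "i \<in> R k" "j \<in> C l"
        then have "\<sigma> i j \<le> Fin (d j - c i)" using offset_pair_le[OF cd] blocks(1)[OF kl(1)] blocks(1)[OF kl(2)] by blast
        then show "\<sigma> i j \<le> Fin (K l - K k + d\<^sub>l l j - c\<^sub>l k i)"
          using split(1)[OF cd kl(1) ij(1)] split(2)[OF cd kl(2) ij(2)] anchor_map kl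
          by (simp add: K algebra_simps)
      qed
      then show "K \<in> block_solutions n \<sigma> p R C" by (auto simp: block_solutions_def K anchor_map_def)
    next
      fix K assume K: "K \<in> block_solutions n \<sigma> p R C"
      obtain r where r: "\<And>i. i \<in> ?X \<Longrightarrow> r i \<in> ?P \<and> i \<in> R (r i)" using blocks(3) by metis
      obtain s where s: "\<And>j. j \<in> ?X \<Longrightarrow> s j \<in> ?P \<and> j \<in> C (s j)" using blocks(4) by metis
      \<comment> \<open>By \<open>split\<close> no other preimage of \<open>K\<close> is
        possible.\<close>
      define c where "c = (\<lambda>i\<in>?X. K (r i) + c\<^sub>l (r i) i)"
      define d where "d = (\<lambda>j\<in>?X. K (s j) + d\<^sub>l (s j) j)"
      have "general_offset_pair ?X ?X \<sigma> c d"
        unfolding general_offset_pair_def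
      proof (intro conjI exI[of _ T] T ballI)
        show "c \<in> int_vectors ?X" "d \<in> int_vectors ?X" by (auto simp: c_def d_def)
        show "\<sigma> i j \<le> Fin (d j - c i)" if ij: "i \<in> ?X" "j \<in> ?X" for i j
        proof -
          have "block_W n \<sigma> R C (r i) (s j) \<le> Fin (K (s j) - K (r i))"
            using K r[OF ij(1)] s[OF ij(2)] by (simp add: block_solutions_def)
          then show ?thesis using W_iff[of "r i" "s j"] r[OF ij(1)] s[OF ij(2)] ij
            by (auto simp: c_def d_def algebra_simps)
        qed
        fix x assume "x \<in> T"
        moreover obtain i j where x: "x = (i, j)" by (cases x)
        ultimately have ij: "(i, j) \<in> T" "i \<in> ?X" "j \<in> ?X" using TX by auto
        \<comment> \<open>Row and column of a position of \<open>T\<close> lie in the same fine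
          block, so the shift by \<open>K\<close> cancels in \<open>d j - c i\<close> and local
          tightness is enough.\<close>
        have "j \<in> C (r i)" using blocks(7)[OF T ij(1)] r[OF ij(2)] by blast
        then have sr: "s j = r i" using blocks(6) s[OF ij(3)] r[OF ij(2)] by blast
        have "(i, j) \<in> essential_pattern (R (r i)) (C (r i)) \<sigma>"
          using local(3)[OF conjunct1[OF r[OF ij(2)]] T] ij(1) r[OF ij(2)] \<open>j \<in> C (r i)\<close>
          unfolding essential_pattern_def by blast
        then have "\<sigma> i j = Fin (d\<^sub>l (r i) j - c\<^sub>l (r i) i)"
          using offset_pair_tight[OF local(1,2)] canon r[OF ij(2)] by blast
        then show "case x of (i, j) \<Rightarrow> Fin (d j - c i) = \<sigma> i j"
          using ij by (simp add: x c_def d_def sr)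
      qed
      then have "c \<in> general_offset_vectors ?X ?X \<sigma>" by (auto simp: general_offset_vectors_def)
      moreover have "K = anchor_map p a c"
      proof
        fix l
        show "K l = anchor_map p a c l"
        proof (cases "l \<in> ?P")
          case True
          then have al: "a l \<in> ?X" using anchor(1) blocks(1) by blast
          then have "r (a l) = l" using blocks(5) r[OF al] anchor(1)[OF True] True by blast
          then show ?thesis using True al anchor(2)[OF True] by (simp add: anchor_map c_def)
        next
          case False
          then show ?thesis using K by (auto simp: block_solutions_def anchor_map_def)
        qed
      qed
      ultimately show "K \<in> anchor_map p a ` general_offset_vectors ?X ?X \<sigma>" by blast
    qed
  qed

  moreover have "(valid ?X c \<longleftrightarrow> valid ?P (anchor_map p a c)) \<and>
      (normalised ?X c \<longleftrightarrow> normalised ?P (anchor_map p a c))"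
    if c: "c \<in> general_offset_vectors ?X ?X \<sigma>" for c
  proof -
    let ?K = "anchor_map p a c"
    \<comment> \<open>Canonical offsets are nonnegative on the block and 0 at the anchor, so each
      block attains its least offset there. As the entries of \<open>?K\<close> are also entries of
      \<open>c\<close>, both vectors have the same minimum.\<close>
    have le: "\<exists>l\<in>?P. ?K l \<le> c i" if i: "i \<in> ?X" for i
    proof -
      obtain l where l: "l \<in> ?P" "i \<in> R l" using blocks(3)[OF i] by blast
      then have "0 \<le> c\<^sub>l l i" using canon by (simp add: valid_def)
      then have "?K l \<le> c i" using c_split[OF c l] anchor_map[OF l(1)] by simp
      then show ?thesis using l(1) by blast
    qed
    have sub: "?K ` ?P \<subseteq> c ` ?X" using anchor(1) blocks(1) anchor_map by fastforce
    have "valid ?X c \<longleftrightarrow> valid ?P ?K"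
    proof
      show "valid ?P ?K" if "valid ?X c" using that sub unfolding valid_def by force
      show "valid ?X c" if "valid ?P ?K" using that le unfolding valid_def by force
    qed
    moreover have "Min (c ` ?X) = Min (?K ` ?P)"
    proof (cases "?X = {}")
      \<comment> \<open>\<open>Min\<close> of the empty set is unspecified; for \<open>n = 0\<close>
        the equality holds because both images are empty.\<close>
      case True
      then show ?thesis using sub by simp
    next
      case False
      then have "?P \<noteq> {}" using le by blast
      show ?thesis
      proof (rule antisym)
        show "Min (c ` ?X) \<le> Min (?K ` ?P)"
          using sub \<open>?P \<noteq> {}\<close> by (intro Min_antimono) auto
        show "Min (?K ` ?P) \<le> Min (c ` ?X)"
        proof (rule Min.boundedI)
          fix y assume "y \<in> c ` ?X"
          then obtain l where "l \<in> ?P" "?K l \<le> y" using le by blast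
          then show "Min (?K ` ?P) \<le> y" by (meson Min_le finite_atLeastAtMost finite_imageI imageI order_trans)
        qed (use False in auto)
      qed
    qed
    ultimately show ?thesis by (simp add: normalised_def)
  qed
  ultimately show ?thesis by blast
qed

end
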